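(* Let $\alpha>0$ and let $\mu$ be a complex Borel measure on $\mathbb{C}$ with $|\mu|(\mathbb{C})<\infty$. Then $T_\mu$ belongs to both $\mathcal{N}(f_\alpha^\infty,F_\alpha^s)$ and $\mathcal{N}(F_\alpha^p,F_\alpha^q)$ for all $1\le p<\infty$ and $1\le q,s\le\infty$. Moreover, for the nuclear norm in each of these spaces, $$\|T_\mu\|_{\mathcal{N}}\le\frac{\alpha}{\pi}\,|\mu|(\mathbb{C}).$$
   Context: Fock spaces: let $dA$ be Lebesgue area measure on $\mathbb{C}$. For $1\le p<\infty$, $F_\alpha^p$ is the Banach space of entire functions $f$ with $\|f\|_{\alpha,p}^p=\frac{p\alpha}{2\pi}\int_{\mathbb{C}}|f(z)e^{-\frac{\alpha}{2}|z|^2}|^p\,dA(z)<\infty$; $F_\alpha^\infty$ is the Banach space of entire functions with $\|f\|_{\alpha,\infty}=\sup_{z}|f(z)|e^{-\alpha|z|^2/2}<\infty$; $f_\alpha^\infty$ is the closed subspace of $F_\alpha^\infty$ of those $f$ with $\lim_{|z|\to\infty}f(z)e^{-\frac{\alpha}{2}|z|^2}=0$. Toeplitz operators: with $K_\alpha(z,w)=e^{\alpha z\overline{w}}$ and $K_z(w)=e^{\alpha w\overline{z}}$, $T_\mu f(z)=\frac{\alpha}{\pi}\int_{\mathbb{C}}K_\alpha(z,w)f(w)e^{-\alpha|w|^2}\,d\mu(w)$. It is well defined on $K=\operatorname{span}\{K_z:z\in\mathbb{C}\}$, which is dense in $F_\alpha^p$ ($1\le p<\infty$) and in $f_\alpha^\infty$.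 "$T_\mu\in\mathcal{N}(X,Y)$" means that $T_\mu$, defined on $K$, extends to an operator in $\mathcal{N}(X,Y)$. $|\mu|$ is the total variation measure. Nuclear operators: for Banach spaces $X,Y$, $\mathcal{N}(X,Y)$ is the set of bounded linear $T:X\to Y$ of the form $Tx=\sum_{j\ge1}x_j'(x)y_j$ with $x_j'\in X'$, $y_j\in Y$, $\sum_j\|x_j'\|_{X'}\|y_j\|_Y<\infty$; $\|T\|_{\mathcal N}$ is the infimum of $\sum_j\|x_j'\|\|y_j\|$ over all such representations. *)

theory Defs
  imports "HOL-Complex_Analysis.Complex_Analysis" "HOL-Library.Function_Algebras"
begin

section \<open>Complex normed spaces with an explicit carrier\<close>

text \<open>
  The Fock spaces depend on real parameters, so they are subsets of a fixed type rather than types.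
  Addition and zero are those of the ambient type; for functions they are the pointwise ones of
  \<open>Function_Algebras\<close>.
\<close>

record 'a cnspace =
  carr :: "'a set"
  scl :: "complex \<Rightarrow> 'a \<Rightarrow> 'a"
  nrm :: "'a \<Rightarrow> real"

definition complex_space :: "complex cnspace" where
  "complex_space = \<lparr>carr = UNIV, scl = (*), nrm = cmod\<rparr>"

text \<open>Values of an operator outside the carrier of its domain are irrelevant throughout.\<close>

definition bounded_ops ::
    "'a::ab_group_add cnspace \<Rightarrow> 'b::ab_group_add cnspace \<Rightarrow> ('a \<Rightarrow> 'b) set" where
  "bounded_ops X Y =
     {T. (\<forall>x\<in>carr X. T x \<in> carr Y) \<and>
         (\<forall>x\<in>carr X. \<forall>y\<in>carr X. T (x + y) = T x + T y) \<and>
         (\<forall>c. \<forall>x\<in>carr X. T (scl X c x) = scl Y c (T x)) \<and>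
         (\<exists>C. \<forall>x\<in>carr X. nrm Y (T x) \<le> C * nrm X x)}"

definition op_norm ::
    "'a::ab_group_add cnspace \<Rightarrow> 'b::ab_group_add cnspace \<Rightarrow> ('a \<Rightarrow> 'b) \<Rightarrow> real" where
  "op_norm X Y T = (SUP x\<in>{x \<in> carr X. nrm X x \<le> 1}. nrm Y (T x))"

abbreviation dual :: "'a::ab_group_add cnspace \<Rightarrow> ('a \<Rightarrow> complex) set" where
  "dual X \<equiv> bounded_ops X complex_space"

abbreviation dual_norm :: "'a::ab_group_add cnspace \<Rightarrow> ('a \<Rightarrow> complex) \<Rightarrow> real" where
  "dual_norm X \<equiv> op_norm X complex_space"

section \<open>Nuclear operators\<close>

definition nuclear_rep ::
    "'a::ab_group_add cnspace \<Rightarrow> 'b::ab_group_add cnspace \<Rightarrow> ('a \<Rightarrow> 'b) \<Rightarrow>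
     (nat \<Rightarrow> 'a \<Rightarrow> complex) \<Rightarrow> (nat \<Rightarrow> 'b) \<Rightarrow> bool" where
  "nuclear_rep X Y T x' y \<longleftrightarrow>
     (\<forall>j. x' j \<in> dual X) \<and> (\<forall>j. y j \<in> carr Y) \<and>
     summable (\<lambda>j. dual_norm X (x' j) * nrm Y (y j)) \<and>
     (\<forall>x\<in>carr X. (\<lambda>n. nrm Y (T x - (\<Sum>j<n. scl Y (x' j x) (y j)))) \<longlonglongrightarrow> 0)"

definition nuclear_ops ::
    "'a::ab_group_add cnspace \<Rightarrow> 'b::ab_group_add cnspace \<Rightarrow> ('a \<Rightarrow> 'b) set" where
  "nuclear_ops X Y = {T \<in> bounded_ops X Y. \<exists>x' y. nuclear_rep X Y T x' y}"

definition nuclear_norm ::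
    "'a::ab_group_add cnspace \<Rightarrow> 'b::ab_group_add cnspace \<Rightarrow> ('a \<Rightarrow> 'b) \<Rightarrow> real" where
  "nuclear_norm X Y T =
     Inf {(\<Sum>j. dual_norm X (x' j) * nrm Y (y j)) | x' y. nuclear_rep X Y T x' y}"

section \<open>Fock spaces\<close>

definition fscale :: "complex \<Rightarrow> ('a \<Rightarrow> complex) \<Rightarrow> 'a \<Rightarrow> complex" where
  "fscale c f = (\<lambda>z. c * f z)"

definition gauss_weighted :: "real \<Rightarrow> (complex \<Rightarrow> complex) \<Rightarrow> complex \<Rightarrow> complex" where
  "gauss_weighted \<alpha> f z = f z * of_real (exp (- (\<alpha> / 2) * (cmod z)\<^sup>2))"

definition fock_norm :: "real \<Rightarrow> ereal \<Rightarrow> (complex \<Rightarrow> complex) \<Rightarrow> real" where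
  "fock_norm \<alpha> p f =
     (if p = \<infinity> then (SUP z. cmod (gauss_weighted \<alpha> f z))
      else (let r = real_of_ereal p in
        (r * \<alpha> / (2 * pi) * (LINT z|lborel. cmod (gauss_weighted \<alpha> f z) powr r)) powr (1 / r)))"

definition fock_set :: "real \<Rightarrow> ereal \<Rightarrow> (complex \<Rightarrow> complex) set" where
  "fock_set \<alpha> p =
     {f. f holomorphic_on UNIV \<and>
         (if p = \<infinity> then bdd_above (range (\<lambda>z. cmod (gauss_weighted \<alpha> f z)))
          else integrable lborel (\<lambda>z. cmod (gauss_weighted \<alpha> f z) powr real_of_ereal p))}"

definition fock :: "real \<Rightarrow> ereal \<Rightarrow> (complex \<Rightarrow> complex) cnspace" where
  "fock \<alpha> p = \<lparr>carr = fock_set \<alpha> p, scl = fscale, nrm = fock_norm \<alpha> p\<rparr>"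

text \<open>The little Fock space, usually written with a lower-case f.\<close>

definition little_fock :: "real \<Rightarrow> (complex \<Rightarrow> complex) cnspace" where
  "little_fock \<alpha> =
     \<lparr>carr = {f \<in> fock_set \<alpha> \<infinity>. (gauss_weighted \<alpha> f \<longlongrightarrow> 0) at_infinity},
      scl = fscale, nrm = fock_norm \<alpha> \<infinity>\<rparr>"

section \<open>Complex measures\<close>

definition complex_measure :: "'a measure \<Rightarrow> ('a set \<Rightarrow> complex) \<Rightarrow> bool" where
  "complex_measure M \<mu> \<longleftrightarrow>
     (\<forall>E. range E \<subseteq> sets M \<longrightarrow> disjoint_family E \<longrightarrow> (\<lambda>n::nat. \<mu> (E n)) sums \<mu> (\<Union>n. E n))"

definition variation :: "'a measure \<Rightarrow> ('a set \<Rightarrow> 'b::real_normed_vector) \<Rightarrow> 'a set \<Rightarrow> ennreal" where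
  "variation M \<nu> A =
     (SUP E\<in>{E. range E \<subseteq> sets M \<and> disjoint_family E \<and> (\<Union>n::nat. E n) = A}.
        (\<Sum>n. ennreal (norm (\<nu> (E n)))))"

text \<open>
  Jordan decomposition of a real (finite signed) measure: the positive part is half of the sum of the
  total variation and the measure itself, and the negative part is the positive part of the negated
  measure. Integration against a complex measure is by linearity over the four Jordan parts.
\<close>

definition pos_part :: "'a measure \<Rightarrow> ('a set \<Rightarrow> real) \<Rightarrow> 'a measure" where
  "pos_part M \<nu> =
     measure_of (space M) (sets M) (\<lambda>A. ennreal ((enn2real (variation M \<nu> A) + \<nu> A) / 2))"

definition signed_integral :: "'a measure \<Rightarrow> ('a set \<Rightarrow> real) \<Rightarrow> ('a \<Rightarrow> complex) \<Rightarrow> complex" where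
  "signed_integral M \<nu> f =
     (LINT x|pos_part M \<nu>. f x) - (LINT x|pos_part M (\<lambda>A. - \<nu> A). f x)"

definition cm_integral :: "'a measure \<Rightarrow> ('a set \<Rightarrow> complex) \<Rightarrow> ('a \<Rightarrow> complex) \<Rightarrow> complex" where
  "cm_integral M \<mu> f =
     signed_integral M (\<lambda>A. Re (\<mu> A)) f + \<i> * signed_integral M (\<lambda>A. Im (\<mu> A)) f"

section \<open>Toeplitz operators\<close>

definition fock_kernel :: "real \<Rightarrow> complex \<Rightarrow> complex \<Rightarrow> complex" where
  "fock_kernel \<alpha> z w = exp (of_real \<alpha> * z * cnj w)"

definition toeplitz :: "real \<Rightarrow> (complex set \<Rightarrow> complex) \<Rightarrow> (complex \<Rightarrow> complex) \<Rightarrow> complex \<Rightarrow> complex" where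
  "toeplitz \<alpha> \<mu> f z =
     of_real (\<alpha> / pi) *
     cm_integral borel \<mu> (\<lambda>w. fock_kernel \<alpha> z w * f w * of_real (exp (- \<alpha> * (cmod w)\<^sup>2)))"

definition kernel_span :: "real \<Rightarrow> (complex \<Rightarrow> complex) set" where
  "kernel_span \<alpha> = module.span fscale (range (\<lambda>z. \<lambda>w. fock_kernel \<alpha> w z))"

definition extends_toeplitz ::
    "real \<Rightarrow> (complex set \<Rightarrow> complex) \<Rightarrow> (complex \<Rightarrow> complex) cnspace \<Rightarrow>
     ((complex \<Rightarrow> complex) \<Rightarrow> complex \<Rightarrow> complex) \<Rightarrow> bool" where
  "extends_toeplitz \<alpha> \<mu> X T \<longleftrightarrow>
     kernel_span \<alpha> \<subseteq> carr X \<and> (\<forall>f\<in>kernel_span \<alpha>. T f = toeplitz \<alpha> \<mu> f)"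

end

theory Submission
  imports Defs "HOL-Probability.Distributions"
begin

text \<open>
  Write \<open>k\<^sub>w\<close> for the reproducing kernel at \<open>w\<close> divided by its norm, and \<open>\<delta>\<^sub>w f = f w * exp (- \<alpha> \<bar>w\<bar>\<^sup>2 / 2)\<close>. The
  definition of the Toeplitz operator reads \<open>T f = \<alpha> / pi * (\<integral>w. \<delta>\<^sub>w f * k\<^sub>w \<partial>\<mu>)\<close>: it is a superposition, with
  respect to \<open>\<mu>\<close>, of the rank-one operators \<open>\<delta>\<^sub>w \<otimes> k\<^sub>w\<close>. Each of these has norm at most one. Indeed
  \<open>k\<^sub>w\<close> has norm one in every Fock space because its weighted modulus is a translated Gaussian
  (\<open>fock_le_normalized_kernel\<close>), and \<open>\<delta>\<^sub>w\<close> is a contraction because the mean of \<open>\<bar>f\<bar> powr p\<close> over a circle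
  dominates the value at the centre (\<open>fock_point_evaluation\<close>). The nuclear norm of \<open>T\<close> should thus be at most
  \<open>\<alpha> / pi\<close> times the total mass of \<open>\<bar>\<mu>\<bar>\<close>.

  To obtain an actual series, both \<open>w \<mapsto> \<delta>\<^sub>w\<close> and \<open>w \<mapsto> k\<^sub>w\<close> are expanded in a telescoping series of
  countably valued maps, which is possible because they are locally Lipschitz in norm
  (\<open>gauss_weighted_lipschitz\<close>, \<open>fock_le_normalized_kernel_diff\<close>, \<open>simple_function_series\<close>). The terms can be chosen
  with norms adding up to at most \<open>1 + \<epsilon>\<close> at every \<open>w\<close>. Multiplying the two expansions gives Borel sets \<open>A i\<close>,
  functionals \<open>x' i\<close> and functions \<open>y i\<close> with \<open>\<delta>\<^sub>w \<otimes> k\<^sub>w = (\<Sum>i. indicator (A i) w * x' i \<otimes> y i)\<close> and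
  \<open>(\<Sum>i. indicator (A i) w * norm (x' i) * norm (y i)) \<le> (1 + \<epsilon>)\<^sup>2\<close> for all \<open>w\<close>. Integration term by term
  (\<open>cm_integral_series\<close>) turns this into \<open>T = \<alpha> / pi * (\<Sum>i. \<mu> (A i) * x' i \<otimes> y i)\<close>, and integrating the norm bound
  against \<open>\<bar>\<mu>\<bar>\<close> shows that this representation costs at most \<open>\<alpha> / pi * \<bar>\<mu>\<bar>(\<complex>) * (1 + \<epsilon>)\<^sup>2\<close>
  (\<open>toeplitz_series\<close>). Finally \<open>\<epsilon>\<close> tends to zero.

  The argument yields pointwise identities between entire functions; convergence in the norm of the target
  space follows from a countable triangle inequality (\<open>fock_le_suminf\<close>). The domain enters only
  through the contractivity of the functionals \<open>\<delta>\<^sub>w\<close>, so the locale \<open>fock_like\<close> treats the little Fock space and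
  the Fock spaces together.
\<close>

section \<open>Variation and Jordan parts\<close>

lemma ennreal_suminf_swap:
  fixes f :: "nat \<Rightarrow> nat \<Rightarrow> ennreal"
  shows "(\<Sum>i. \<Sum>j. f i j) = (\<Sum>j. \<Sum>i. f i j)"
proof -
  have "(\<Sum>i. \<Sum>j. f i j) = (\<integral>\<^sup>+i. (\<Sum>j. f i j) \<partial>count_space UNIV)"
    by (simp add: nn_integral_count_space_nat)
  also have "\<dots> = (\<Sum>j. \<integral>\<^sup>+i. f i j \<partial>count_space UNIV)"
    by (rule nn_integral_suminf) simp
  finally show ?thesis by (simp add: nn_integral_count_space_nat)
qed

lemma ennreal_norm_suminf_le:
  fixes f :: "nat \<Rightarrow> 'b::banach"
  assumes "f sums s"
  shows "ennreal (norm s) \<le> (\<Sum>n. ennreal (norm (f n)))"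
proof (cases "summable (\<lambda>n. norm (f n))")
  case True
  then show ?thesis
    using summable_norm[OF True] sums_unique[OF assms]
    by (simp add: suminf_ennreal2 ennreal_leI)
next
  case False
  then have "(\<Sum>n. ennreal (norm (f n))) = top"
    using summable_suminf_not_top[of "\<lambda>n. norm (f n)", OF norm_ge_zero] by blast
  then show ?thesis by simp
qed

lemma variation_upper:
  assumes "range E \<subseteq> sets M" "disjoint_family E" "(\<Union>n::nat. E n) = A"
  shows "(\<Sum>n. ennreal (norm (\<nu> (E n)))) \<le> variation M \<nu> A"
  unfolding variation_def by (rule SUP_upper) (use assms in auto)

text \<open>
  Values in a Banach space: complex measures are one instance, their real and imaginary parts are
  two others, and the variation of all of them is needed.
\<close>

locale vector_measure =
  fixes M :: "'a measure" and \<nu> :: "'a set \<Rightarrow> 'b::banach"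
  assumes countably_additive_nu:
    "range E \<subseteq> sets M \<Longrightarrow> disjoint_family E \<Longrightarrow> (\<lambda>n::nat. \<nu> (E n)) sums \<nu> (\<Union>n. E n)"
begin

lemma nu_empty [simp]: "\<nu> {} = 0"
proof -
  have "(\<lambda>n::nat. \<nu> {}) sums \<nu> {}"
    using countably_additive_nu[of "\<lambda>_. {}"] by (simp add: disjoint_family_on_def)
  then have "(\<lambda>n::nat. \<nu> {}) \<longlonglongrightarrow> 0"
    by (intro summable_LIMSEQ_zero sums_summable)
  then show ?thesis by (simp add: LIMSEQ_const_iff)
qed

lemma norm_le_variation:
  assumes "A \<in> sets M"
  shows "ennreal (norm (\<nu> A)) \<le> variation M \<nu> A"
proof -
  let ?E = "\<lambda>n::nat. if n = 0 then A else {}"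
  have "(\<Sum>n. ennreal (norm (\<nu> (?E n)))) \<le> variation M \<nu> A"
    by (rule variation_upper) (use assms in \<open>auto simp: disjoint_family_on_def\<close>)
  also have "(\<Sum>n. ennreal (norm (\<nu> (?E n)))) = (\<Sum>n\<in>{0}. ennreal (norm (\<nu> (?E n))))"
    by (rule suminf_finite) auto
  finally show ?thesis by simp
qed

lemma variation_empty [simp]: "variation M \<nu> {} = 0"
proof -
  have "variation M \<nu> {} \<le> 0"
    unfolding variation_def by (rule SUP_least) auto
  then show ?thesis by simp
qed

lemma variation_superadditive:
  assumes AB: "A \<in> sets M" "B \<in> sets M" "A \<inter> B = {}"
  shows "variation M \<nu> A + variation M \<nu> B \<le> variation M \<nu> (A \<union> B)"
proof -
  let ?P = "\<lambda>A. {E. range E \<subseteq> sets M \<and> disjoint_family E \<and> (\<Union>n::nat. E n) = A}"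
  let ?v = "\<lambda>E. \<Sum>n. ennreal (norm (\<nu> (E n)))"
  have ne: "?P C \<noteq> {}" if "C \<in> sets M" for C
    using that by (intro ex_in_conv[THEN iffD1] exI[of _ "\<lambda>n. if n = 0 then C else {}"])
      (auto simp: disjoint_family_on_def)
  have two: "?v E + ?v F \<le> variation M \<nu> (A \<union> B)" if E: "E \<in> ?P A" and F: "F \<in> ?P B" for E F
  proof -
    \<comment> \<open>Interleave the two partitions.\<close>
    define G where "G n = (if even n then E (n div 2) else F (n div 2))" for n
    have split: "?v G = ?v E + ?v F"
    proof -
      have "(\<Sum>n<k. ennreal (norm (\<nu> (E n)))) + (\<Sum>n<k. ennreal (norm (\<nu> (F n)))) =
            (\<Sum>n<2*k. ennreal (norm (\<nu> (G n))))" for k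
        by (induction k) (auto simp: G_def ac_simps)
      moreover have "(\<lambda>k. (\<Sum>n<k. ennreal (norm (\<nu> (E n)))) + (\<Sum>n<k. ennreal (norm (\<nu> (F n)))))
          \<longlonglongrightarrow> ?v E + ?v F"
        by (intro tendsto_add summable_LIMSEQ) auto
      moreover have "(\<lambda>k. \<Sum>n<2*k. ennreal (norm (\<nu> (G n)))) \<longlonglongrightarrow> ?v G"
        by (rule LIMSEQ_subseq_LIMSEQ[OF summable_LIMSEQ, unfolded o_def])
           (auto simp: strict_mono_def)
      ultimately show ?thesis by (metis (no_types, lifting) LIMSEQ_unique ext)
    qed
    have rng: "range G \<subseteq> sets M"
      using E F by (auto simp: G_def)
    have sub: "E n \<subseteq> A" "F n \<subseteq> B" for n using E F by auto
    have "disjoint_family G"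
      unfolding disjoint_family_on_def
    proof (intro ballI impI)
      fix m n :: nat assume "m \<noteq> n"
      then have *: "even m = even n \<Longrightarrow> m div 2 \<noteq> n div 2"
        by (metis dvd_mult_div_cancel odd_two_times_div_two_succ)
      have d: "i \<noteq> j \<Longrightarrow> E i \<inter> E j = {}" "i \<noteq> j \<Longrightarrow> F i \<inter> F j = {}" for i j
        using E F by (auto simp: disjoint_family_on_def)
      have e: "E i \<inter> F j = {}" "F j \<inter> E i = {}" for i j using sub[of i] sub[of j] AB(3) by blast+
      show "G m \<inter> G n = {}"
        by (cases "even m"; cases "even n") (use * d e in \<open>simp_all add: G_def\<close>)
    qed
    moreover have "(\<Union>n. G n) = A \<union> B"
    proof -
      have "(\<Union>n. G n) = (\<Union>n. E n) \<union> (\<Union>n. F n)"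
      proof (intro set_eqI iffI)
        fix x assume "x \<in> (\<Union>n. E n) \<union> (\<Union>n. F n)"
        then obtain n where "x \<in> E n \<or> x \<in> F n" by auto
        then have "x \<in> G (2*n) \<or> x \<in> G (2*n+1)" by (auto simp: G_def)
        then show "x \<in> (\<Union>n. G n)" by blast
      qed (auto simp: G_def split: if_splits)
      then show ?thesis using E F by auto
    qed
    ultimately show ?thesis using variation_upper[OF rng] split by metis
  qed
  have "variation M \<nu> A + variation M \<nu> B = (SUP E\<in>?P A. ?v E + variation M \<nu> B)"
    unfolding variation_def[of M \<nu> A] by (rule ennreal_SUP_add_left[OF ne[OF AB(1)], symmetric])
  also have "\<dots> = (SUP E\<in>?P A. SUP F\<in>?P B. ?v E + ?v F)"
    unfolding variation_def[of M \<nu> B]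
    by (intro SUP_cong refl ennreal_SUP_add_right[OF ne[OF AB(2)]])
  also have "\<dots> \<le> variation M \<nu> (A \<union> B)"
    by (intro SUP_least two)
  finally show ?thesis .
qed

lemma variation_mono:
  assumes "A \<in> sets M" "B \<in> sets M" "A \<subseteq> B"
  shows "variation M \<nu> A \<le> variation M \<nu> B"
proof -
  have "variation M \<nu> A + variation M \<nu> (B - A) \<le> variation M \<nu> (A \<union> (B - A))"
    using assms by (intro variation_superadditive) auto
  also have "A \<union> (B - A) = B" using assms by auto
  finally show ?thesis by (meson le_iff_add order_trans)
qed

text \<open>
  The lower bound comes from superadditivity on finite unions. For the upper bound, any partition
  \<open>E\<close> of the union is cut along the sets \<open>A n\<close>; the pieces \<open>E k \<inter> A n\<close>, with
  \<open>n\<close> fixed, partition \<open>A n\<close>, and the two summations may be exchanged.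
\<close>

lemma variation_suminf:
  assumes A: "range A \<subseteq> sets M" "disjoint_family A"
  shows "(\<Sum>n::nat. variation M \<nu> (A n)) = variation M \<nu> (\<Union>n. A n)"
proof (rule antisym)
  have "(\<Sum>n<k. variation M \<nu> (A n)) \<le> variation M \<nu> (\<Union>n<k. A n)" for k
  proof (induction k)
    case (Suc k)
    have "(\<Sum>n<Suc k. variation M \<nu> (A n)) \<le> variation M \<nu> (\<Union>n<k. A n) + variation M \<nu> (A k)"
      using Suc by (simp add: add_right_mono)
    also have "\<dots> \<le> variation M \<nu> ((\<Union>n<k. A n) \<union> A k)"
    proof (rule variation_superadditive)
      show "(\<Union>n<k. A n) \<inter> A k = {}"
      proof -
        have "A n \<inter> A k = {}" if "n < k" for n
          using A(2) that by (simp add: disjoint_family_on_def)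
        then show ?thesis by blast
      qed
    qed (use A in auto)
    finally show ?case by (simp add: lessThan_Suc Un_commute)
  qed simp
  also have "variation M \<nu> (\<Union>n<k. A n) \<le> variation M \<nu> (\<Union>n. A n)" for k
    using A by (intro variation_mono) auto
  finally show "(\<Sum>n. variation M \<nu> (A n)) \<le> variation M \<nu> (\<Union>n. A n)"
    by (intro suminf_le_const) auto
next
  show "variation M \<nu> (\<Union>n. A n) \<le> (\<Sum>n. variation M \<nu> (A n))"
    unfolding variation_def[of M \<nu> "\<Union>n. A n"]
  proof (rule SUP_least, clarsimp)
    fix E :: "nat \<Rightarrow> 'a set"
    assume E: "range E \<subseteq> sets M" "disjoint_family E" "(\<Union>n. E n) = (\<Union>n. A n)"
    have "ennreal (norm (\<nu> (E k))) \<le> (\<Sum>n. ennreal (norm (\<nu> (E k \<inter> A n))))" for k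
    proof (rule ennreal_norm_suminf_le)
      have "(\<lambda>n. \<nu> (E k \<inter> A n)) sums \<nu> (\<Union>n. E k \<inter> A n)"
        using A E(1) by (intro countably_additive_nu disjoint_family_on_bisimulation[OF A(2)]) auto
      also have "(\<Union>n. E k \<inter> A n) = E k" using E(3) by blast
      finally show "(\<lambda>n. \<nu> (E k \<inter> A n)) sums \<nu> (E k)" .
    qed
    then have "(\<Sum>k. ennreal (norm (\<nu> (E k)))) \<le> (\<Sum>k. \<Sum>n. ennreal (norm (\<nu> (E k \<inter> A n))))"
      by (intro suminf_le) auto
    also have "\<dots> = (\<Sum>n. \<Sum>k. ennreal (norm (\<nu> (E k \<inter> A n))))"
      by (rule ennreal_suminf_swap)
    also have "\<dots> \<le> (\<Sum>n. variation M \<nu> (A n))"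
    proof (intro suminf_le variation_upper)
      show "range (\<lambda>k. E k \<inter> A n) \<subseteq> sets M" for n using A E by auto
      show "disjoint_family (\<lambda>k. E k \<inter> A n)" for n
        by (rule disjoint_family_on_bisimulation[OF E(2)]) auto
      show "(\<Union>k. E k \<inter> A n) = A n" for n using E(3) by blast
    qed auto
    finally show "(\<Sum>k. ennreal (norm (\<nu> (E k)))) \<le> (\<Sum>n. variation M \<nu> (A n))" .
  qed
qed

definition var_measure :: "'a measure" where
  "var_measure = measure_of (space M) (sets M) (variation M \<nu>)"

lemma sets_var_measure [simp, measurable_cong]: "sets var_measure = sets M"
  and space_var_measure [simp]: "space var_measure = space M"
  by (simp_all add: var_measure_def)

lemma emeasure_var_measure:
  assumes "A \<in> sets M" shows "emeasure var_measure A = variation M \<nu> A"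
proof (rule emeasure_measure_of[OF var_measure_def])
  show "countably_additive (sets var_measure) (variation M \<nu>)"
    by (simp add: countably_additive_def variation_suminf)
qed (use assms sets.space_closed[of M] in \<open>simp_all add: positive_def\<close>)

end

lemma variation_uminus: "variation M (\<lambda>A. - \<nu> A) = variation M \<nu>"
  by (rule ext) (simp add: variation_def)

locale finite_signed_measure = vector_measure M \<nu> for M and \<nu> :: "'a set \<Rightarrow> real" +
  assumes finite_variation: "variation M \<nu> (space M) < \<infinity>"
begin

lemma variation_finite: "A \<in> sets M \<Longrightarrow> variation M \<nu> A < top"
  using variation_mono[of A "space M"] finite_variation sets.sets_into_space[of A M]
  by (auto simp: less_top[symmetric] top_unique)

lemma abs_le_variation: "A \<in> sets M \<Longrightarrow> \<bar>\<nu> A\<bar> \<le> enn2real (variation M \<nu> A)"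
  using norm_le_variation[of A] variation_finite[of A]
  by (cases "variation M \<nu> A" rule: ennreal_cases) auto

lemma finite_signed_measure_uminus: "finite_signed_measure M (\<lambda>A. - \<nu> A)"
  by standard (use countably_additive_nu finite_variation in \<open>auto simp: variation_uminus intro: sums_minus\<close>)

lemma sets_pos_part [simp, measurable_cong]: "sets (pos_part M \<nu>) = sets M"
  and space_pos_part [simp]: "space (pos_part M \<nu>) = space M"
  by (simp_all add: pos_part_def)

text \<open>
  Measures built with \<open>measure_of\<close> are null unless the underlying set function is a measure, so
  integrals against \<open>pos_part\<close> carry information only through this lemma.
\<close>

lemma emeasure_pos_part:
  assumes "A \<in> sets M"
  shows "emeasure (pos_part M \<nu>) A = ennreal ((enn2real (variation M \<nu> A) + \<nu> A) / 2)"
  unfolding pos_part_def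
proof (rule emeasure_measure_of)
  let ?f = "\<lambda>A. ennreal ((enn2real (variation M \<nu> A) + \<nu> A) / 2)"
  show "countably_additive (sets (measure_of (space M) (sets M) ?f)) ?f"
    unfolding countably_additive_def
  proof (intro allI impI)
    fix E :: "nat \<Rightarrow> 'a set"
    assume "range E \<subseteq> sets (measure_of (space M) (sets M) ?f)" and d: "disjoint_family E"
    then have E: "range E \<subseteq> sets M" by simp
    then have En: "E n \<in> sets M" for n by auto
    have e: "variation M \<nu> (E n) = ennreal (enn2real (variation M \<nu> (E n)))" for n
      using variation_finite[OF En] by simp
    have U: "(\<Union>n. E n) \<in> sets M" using E by auto
    have "(\<lambda>n. variation M \<nu> (E n)) sums variation M \<nu> (\<Union>n. E n)"
      using variation_suminf[OF E d] by (metis summableI summable_sums)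
    then have "(\<lambda>n. ennreal (enn2real (variation M \<nu> (E n)))) sums ennreal (enn2real (variation M \<nu> (\<Union>n. E n)))"
      using variation_finite[OF U] variation_finite[OF En] by simp
    then have "(\<lambda>n. enn2real (variation M \<nu> (E n))) sums enn2real (variation M \<nu> (\<Union>n. E n))"
      by (subst (asm) sums_ennreal) auto
    then have "(\<lambda>n. (enn2real (variation M \<nu> (E n)) + \<nu> (E n)) / 2) sums
               ((enn2real (variation M \<nu> (\<Union>n. E n)) + \<nu> (\<Union>n. E n)) / 2)"
      by (intro sums_divide sums_add countably_additive_nu E d)
    moreover have "0 \<le> (enn2real (variation M \<nu> B) + \<nu> B) / 2" if "B \<in> sets M" for B
      using abs_le_variation[OF that] by simp
    ultimately have "(\<lambda>n. ?f (E n)) sums ?f (\<Union>n. E n)"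
      using En U by (subst sums_ennreal) auto
    then show "(\<Sum>n. ?f (E n)) = ?f (\<Union>n. E n)" by (rule sums_unique[symmetric])
  qed
qed (use assms sets.space_closed[of M] in \<open>simp_all add: positive_def\<close>)

lemma finite_pos_part: "finite_measure (pos_part M \<nu>)"
  by standard (simp add: emeasure_pos_part)

lemma measure_pos_part:
  assumes "A \<in> sets M"
  shows "measure (pos_part M \<nu>) A = (enn2real (variation M \<nu> A) + \<nu> A) / 2"
  using abs_le_variation[OF assms] by (simp add: measure_def emeasure_pos_part[OF assms])

end

text \<open>
  Dominated convergence: on a finite measure space the constant \<open>B\<close> is an integrable majorant of all
  partial sums.
\<close>

lemma (in finite_measure) sums_integral_indicators:
  fixes h :: "nat \<Rightarrow> complex"
  assumes A[measurable]: "\<And>i. A i \<in> sets M"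
    and F: "\<And>w. w \<in> space M \<Longrightarrow> (\<lambda>i. indicator (A i) w * h i) sums F w"
    and B: "\<And>w n. w \<in> space M \<Longrightarrow> (\<Sum>i<n. indicator (A i) w * cmod (h i)) \<le> B"
  shows "(\<lambda>i. measure M (A i) * h i) sums (LINT w|M. F w)"
proof -
  have Sm[measurable]: "(\<lambda>w. \<Sum>i<n. indicator (A i) w * h i) \<in> borel_measurable M" for n
    by measurable
  have Fm[measurable]: "F \<in> borel_measurable M"
    by (rule borel_measurable_LIMSEQ_metric[OF Sm]) (use F in \<open>simp add: sums_def\<close>)
  have "(\<lambda>n. LINT w|M. (\<Sum>i<n. indicator (A i) w * h i)) \<longlonglongrightarrow> (LINT w|M. F w)"
  proof (rule integral_dominated_convergence[where w="\<lambda>_. B"])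
    show "AE w in M. (\<lambda>n. \<Sum>i<n. indicator (A i) w * h i) \<longlonglongrightarrow> F w"
      using F by (intro AE_I2) (simp add: sums_def)
    have "cmod (\<Sum>i<n. indicator (A i) w * h i) \<le> B" if "w \<in> space M" for w n
    proof -
      have "cmod (\<Sum>i<n. indicator (A i) w * h i) \<le> (\<Sum>i<n. cmod (indicator (A i) w * h i))"
        by (rule norm_sum)
      also have "\<dots> = (\<Sum>i<n. indicator (A i) w * cmod (h i))"
        by (intro sum.cong refl) (simp split: split_indicator)
      finally show ?thesis using B[OF that, of n] by linarith
    qed
    then show "AE w in M. cmod (\<Sum>i<n. indicator (A i) w * h i) \<le> B" for n by (intro AE_I2)
  qed (use Sm Fm in simp_all)
  moreover have "(LINT w|M. (\<Sum>i<n. indicator (A i) w * h i)) = (\<Sum>i<n. measure M (A i) * h i)" for n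
  proof -
    have "has_bochner_integral M (\<lambda>w. indicator (A i) w *\<^sub>R h i) (measure M (A i) *\<^sub>R h i)" for i
      by (intro has_bochner_integral_scaleR_left has_bochner_integral_real_indicator A)
         (simp add: emeasure_eq_measure)
    then have "has_bochner_integral M (\<lambda>w. \<Sum>i<n. indicator (A i) w *\<^sub>R h i) (\<Sum>i<n. measure M (A i) *\<^sub>R h i)"
      by (intro has_bochner_integral_sum)
    moreover have ind: "indicator (A i) w *\<^sub>R h i = indicator (A i) w * h i" for i w
      by (simp add: indicator_def)
    ultimately have "has_bochner_integral M (\<lambda>w. \<Sum>i<n. indicator (A i) w * h i) (\<Sum>i<n. measure M (A i) *\<^sub>R h i)"
      by (simp only: ind)
    then show ?thesis
      unfolding scaleR_conv_of_real by (rule has_bochner_integral_integral_eq)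
  qed
  ultimately show ?thesis by (simp only: sums_def)
qed

lemma vector_measure_bounded_linear:
  assumes "vector_measure M \<nu>" "bounded_linear T"
  shows "vector_measure M (\<lambda>A. T (\<nu> A))"
  using assms by (auto simp: vector_measure_def intro: bounded_linear.sums)

lemma variation_contraction:
  assumes "\<And>A. norm (T (\<nu> A)) \<le> norm (\<nu> A)"
  shows "variation M (\<lambda>A. T (\<nu> A)) B \<le> variation M \<nu> B"
  unfolding variation_def
proof (rule SUP_mono)
  fix E assume "E \<in> {E. range E \<subseteq> sets M \<and> disjoint_family E \<and> (\<Union>n::nat. E n) = B}"
  moreover have "(\<Sum>n. ennreal (norm (T (\<nu> (E n))))) \<le> (\<Sum>n. ennreal (norm (\<nu> (E n))))"
    by (intro suminf_le ennreal_leI assms) auto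
  ultimately show "\<exists>F\<in>{E. range E \<subseteq> sets M \<and> disjoint_family E \<and> (\<Union>n::nat. E n) = B}.
      (\<Sum>n. ennreal (norm (T (\<nu> (E n))))) \<le> (\<Sum>n. ennreal (norm (\<nu> (F n))))" by blast
qed

lemma signed_integral_series:
  assumes "finite_signed_measure M \<nu>"
    and A: "\<And>i. A i \<in> sets M"
    and F: "\<And>w. w \<in> space M \<Longrightarrow> (\<lambda>i. indicator (A i) w * h i) sums F w"
    and B: "\<And>w n. w \<in> space M \<Longrightarrow> (\<Sum>i<n. indicator (A i) w * cmod (h i)) \<le> B"
  shows "(\<lambda>i. complex_of_real (\<nu> (A i)) * h i) sums signed_integral M \<nu> F"
proof -
  interpret finite_signed_measure M \<nu> by fact
  interpret n: finite_signed_measure M "\<lambda>A. - \<nu> A" by (rule finite_signed_measure_uminus)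
  have "(\<lambda>i. measure (pos_part M \<nu>) (A i) * h i - measure (pos_part M (\<lambda>A. - \<nu> A)) (A i) * h i)
     sums signed_integral M \<nu> F"
    unfolding signed_integral_def
    by (intro sums_diff finite_measure.sums_integral_indicators[where B=B]
        finite_pos_part n.finite_pos_part) (use assms in auto)
  moreover have "measure (pos_part M \<nu>) (A i) - measure (pos_part M (\<lambda>A. - \<nu> A)) (A i) = \<nu> (A i)" for i
    using A by (simp add: measure_pos_part n.measure_pos_part variation_uminus diff_divide_distrib[symmetric])
  then have "measure (pos_part M \<nu>) (A i) * h i - measure (pos_part M (\<lambda>A. - \<nu> A)) (A i) * h i =
     complex_of_real (\<nu> (A i)) * h i" for i
    by (metis left_diff_distrib of_real_diff)
  ultimately show ?thesis by simp
qed

text \<open>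
  The Jordan parts of a signed measure recombine to its values, \<open>\<nu>\<^sup>+ A - \<nu>\<^sup>- A = \<nu> A\<close>, so on countably
  valued integrands the integral is the series that one expects. The Toeplitz integrand is only ever
  integrated in this form.
\<close>

lemma cm_integral_series:
  assumes cm: "complex_measure M \<mu>" and fin: "variation M \<mu> (space M) < \<infinity>"
    and A: "\<And>i. A i \<in> sets M"
    and F: "\<And>w. w \<in> space M \<Longrightarrow> (\<lambda>i. indicator (A i) w * h i) sums F w"
    and B: "\<And>w n. w \<in> space M \<Longrightarrow> (\<Sum>i<n. indicator (A i) w * cmod (h i)) \<le> B"
  shows "(\<lambda>i. \<mu> (A i) * h i) sums cm_integral M \<mu> F"
proof -
  have v: "vector_measure M \<mu>"
    using cm by (simp add: complex_measure_def vector_measure_def)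
  have fs: "finite_signed_measure M (\<lambda>A. T (\<mu> A))"
    if "bounded_linear T" "\<And>z. norm (T z) \<le> norm z" for T :: "complex \<Rightarrow> real"
    using vector_measure_bounded_linear[OF v that(1)] fin
      variation_contraction[of T \<mu> M "space M", OF that(2)]
    by (auto simp: finite_signed_measure_def finite_signed_measure_axioms_def less_top[symmetric] top_unique)
  have "(\<lambda>i. complex_of_real (Re (\<mu> (A i))) * h i + \<i> * (complex_of_real (Im (\<mu> (A i))) * h i))
     sums cm_integral M \<mu> F"
    unfolding cm_integral_def
    by (intro sums_add sums_mult signed_integral_series[where B=B] fs A F B bounded_linear_Re bounded_linear_Im)
       (auto simp: abs_Re_le_cmod abs_Im_le_cmod)
  moreover have "complex_of_real (Re z) * c + \<i> * (complex_of_real (Im z) * c) = z * c" for z c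
    by (metis complex_eq distrib_right mult.assoc)
  ultimately show ?thesis by simp
qed

section \<open>Convexity of powers\<close>

text \<open>
  Jensen's inequality is obtained below by averaging this inequality with \<open>a\<close> the mean of the values
  \<open>t\<close>: the linear term then drops out. It is used once for finite sums and once on circles.
\<close>

lemma powr_above_tangent:
  fixes a t r :: real
  assumes "0 < a" "0 \<le> t" "1 \<le> r"
  shows "a powr r + r * a powr (r - 1) * (t - a) \<le> t powr r"
proof (cases "t = 0")
  case True
  have e: "a powr r = a powr (r - 1) * a" using assms by (simp add: powr_diff)
  have "0 \<le> a powr (r - 1) * a * (r - 1)" using assms by simp
  also have "a powr (r - 1) * a * (r - 1) = - (a powr (r - 1) * a + r * a powr (r - 1) * (0 - a))"
    by (simp only: ring_distribs minus_mult_right mult_ac)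
  finally have "a powr r + r * a powr (r - 1) * (0 - a) \<le> 0" unfolding e by linarith
  then show ?thesis unfolding True powr_0 .
next
  case False
  have "(\<lambda>x. x powr r) a + r * a powr (r - 1) * (t - a) \<le> (\<lambda>x. x powr r) t"
  proof -
    have "((\<lambda>x. x powr r) has_field_derivative r * a powr (r - 1)) (at a within {0<..})"
      using has_real_derivative_powr[OF assms(1), of r] by (rule DERIV_subset) simp
    from convex_on_imp_above_tangent[OF powr_convex[OF assms(3)] _ _ _ this, of t] show ?thesis
      using assms False by (simp add: interior_open algebra_simps)
  qed
  then show ?thesis by simp
qed

text \<open>
  Jensen's inequality for the numbers \<open>b j / a j\<close> with weights proportional to \<open>a j\<close>. With
  \<open>b j = \<bar>h j z\<bar>\<close> and \<open>a j\<close> a bound for the norm of \<open>h j\<close>, integration over \<open>z\<close> yields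
  Minkowski's inequality for arbitrarily many summands at once.
\<close>

lemma powr_sum_le_weighted:
  fixes a b :: "nat \<Rightarrow> real" and r :: real
  assumes r: "1 \<le> r" and a: "\<And>j. 0 \<le> a j" and b: "\<And>j. 0 \<le> b j" and ab: "\<And>j. a j = 0 \<Longrightarrow> b j = 0"
  shows "(\<Sum>j<n. b j) powr r \<le> (\<Sum>j<n. a j) powr (r - 1) * (\<Sum>j<n. a j powr (1 - r) * b j powr r)"
proof (cases "(\<Sum>j<n. b j) = 0")
  case True
  then show ?thesis by (simp add: sum_nonneg)
next
  case False
  define A where "A = (\<Sum>j<n. a j)"
  define B where "B = (\<Sum>j<n. b j)"
  have B: "0 < B" using False b unfolding B_def by (metis less_eq_real_def sum_nonneg)
  have "A \<noteq> 0"
  proof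
    assume "A = 0"
    then have "\<forall>j\<in>{..<n}. a j = 0" unfolding A_def using a by (subst (asm) sum_nonneg_eq_0_iff) auto
    then show False using ab False by simp
  qed
  then have A: "0 < A" using a unfolding A_def by (metis less_eq_real_def sum_nonneg)
  have "a j * (B/A) powr r + r * (B/A) powr (r - 1) * (b j - a j * (B/A)) \<le> a j powr (1 - r) * b j powr r" for j
  proof (cases "a j = 0")
    case False
    then have p: "0 < a j" using a[of j] by linarith
    have "a j * ((B/A) powr r + r * (B/A) powr (r - 1) * (b j / a j - B/A)) \<le> a j * (b j / a j) powr r"
      using p A B r b by (intro mult_left_mono powr_above_tangent) auto
    also have "\<dots> = a j powr (1 - r) * b j powr r"
      using p b by (simp add: powr_divide powr_diff)
    finally show ?thesis using p by (simp add: algebra_simps)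
  qed (use ab in simp)
  then have "(\<Sum>j<n. a j * (B/A) powr r + r * (B/A) powr (r - 1) * (b j - a j * (B/A)))
      \<le> (\<Sum>j<n. a j powr (1 - r) * b j powr r)" by (intro sum_mono)
  also have "(\<Sum>j<n. a j * (B/A) powr r + r * (B/A) powr (r - 1) * (b j - a j * (B/A)))
      = A * (B/A) powr r + r * (B/A) powr (r - 1) * (B - A * (B/A))"
    by (simp only: sum.distrib sum_subtractf A_def B_def sum_distrib_left[symmetric] sum_distrib_right[symmetric])
  also have "\<dots> = A powr (1 - r) * B powr r"
    using A B by (simp add: powr_divide powr_diff)
  finally have "A powr (r - 1) * (A powr (1 - r) * B powr r) \<le> A powr (r - 1) * (\<Sum>j<n. a j powr (1 - r) * b j powr r)"
    by (rule mult_left_mono) simp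
  moreover have "A powr (r - 1) * (A powr (1 - r) * B powr r) = B powr r"
    using A by (simp add: powr_add[symmetric] mult.assoc[symmetric])
  ultimately show ?thesis unfolding A_def B_def by simp
qed

section \<open>Lebesgue measure on the complex plane\<close>

lemma nn_integral_lborel_translate:
  fixes c :: "'a::euclidean_space"
  assumes [measurable]: "f \<in> borel_measurable borel"
  shows "(\<integral>\<^sup>+x. f (x + c) \<partial>lborel) = (\<integral>\<^sup>+x. f x \<partial>lborel)"
proof -
  have "(\<integral>\<^sup>+x. f x \<partial>lborel) = (\<integral>\<^sup>+x. f x \<partial>distr lborel borel ((+) c))"
    by (simp only: lborel_distr_plus)
  also have "\<dots> = (\<integral>\<^sup>+x. f (c + x) \<partial>lborel)"
    by (rule nn_integral_distr) measurable
  finally show ?thesis by (simp add: add.commute)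
qed

lemma borel_measurable_Complex [measurable (raw)]:
  assumes "f \<in> borel_measurable M" "g \<in> borel_measurable M"
  shows "(\<lambda>x. Complex (f x) (g x)) \<in> borel_measurable M"
  using assms by (simp add: borel_measurable_complex_iff)

lemma lborel_complex_eq_distr:
  "(lborel :: complex measure) = distr (lborel \<Otimes>\<^sub>M lborel) borel (\<lambda>p. Complex (fst p) (snd p))"
proof (rule lborel_eqI)
  fix l u :: complex
  assume lu: "\<And>b. b \<in> Basis \<Longrightarrow> l \<bullet> b \<le> u \<bullet> b"
  have le: "Re l \<le> Re u" "Im l \<le> Im u"
    using lu[of 1] lu[of \<i>] by (auto simp: Basis_complex_def)
  have "(\<lambda>p. Complex (fst p) (snd p)) -` box l u \<inter> space (lborel \<Otimes>\<^sub>M lborel)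
      = {Re l<..<Re u} \<times> {Im l<..<Im u}"
    by (auto simp: box_def Basis_complex_def space_pair_measure)
  then show "emeasure (distr (lborel \<Otimes>\<^sub>M lborel) borel (\<lambda>p. Complex (fst p) (snd p))) (box l u)
      = (\<Prod>b\<in>Basis. (u - l) \<bullet> b)"
    using le by (simp add: emeasure_distr lborel.emeasure_pair_measure_Times Basis_complex_def
        ennreal_mult)
qed simp

lemma nn_integral_lborel_complex:
  assumes [measurable]: "f \<in> borel_measurable borel"
  shows "(\<integral>\<^sup>+z. f z \<partial>lborel) = (\<integral>\<^sup>+y. \<integral>\<^sup>+x. f (Complex x y) \<partial>lborel \<partial>lborel)"
    and "(\<integral>\<^sup>+z. f z \<partial>lborel) = (\<integral>\<^sup>+x. \<integral>\<^sup>+y. f (Complex x y) \<partial>lborel \<partial>lborel)"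
proof -
  have *: "(\<integral>\<^sup>+z. f z \<partial>lborel) = (\<integral>\<^sup>+p. f (Complex (fst p) (snd p)) \<partial>(lborel \<Otimes>\<^sub>M lborel))"
    by (subst lborel_complex_eq_distr) (simp add: nn_integral_distr)
  show "(\<integral>\<^sup>+z. f z \<partial>lborel) = (\<integral>\<^sup>+y. \<integral>\<^sup>+x. f (Complex x y) \<partial>lborel \<partial>lborel)"
    unfolding * by (subst lborel_pair.nn_integral_snd[symmetric]) simp_all
  show "(\<integral>\<^sup>+z. f z \<partial>lborel) = (\<integral>\<^sup>+x. \<integral>\<^sup>+y. f (Complex x y) \<partial>lborel \<partial>lborel)"
    unfolding * by (subst lborel.nn_integral_fst[symmetric]) simp_all
qed

text \<open>
  In iterated integrals a shear merely translates the inner variable, by an amount that depends on the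
  outer one.
\<close>

lemma nn_integral_complex_shear:
  assumes [measurable]: "f \<in> borel_measurable borel"
  shows "(\<integral>\<^sup>+z. f (Complex (Re z + t * Im z) (Im z)) \<partial>lborel) = (\<integral>\<^sup>+z. f z \<partial>lborel)"
    and "(\<integral>\<^sup>+z. f (Complex (Re z) (Im z + t * Re z)) \<partial>lborel) = (\<integral>\<^sup>+z. f z \<partial>lborel)"
proof -
  show "(\<integral>\<^sup>+z. f (Complex (Re z + t * Im z) (Im z)) \<partial>lborel) = (\<integral>\<^sup>+z. f z \<partial>lborel)"
    using nn_integral_lborel_translate[of "\<lambda>x. f (Complex x y)" "t * y" for y]
    by (simp add: nn_integral_lborel_complex(1))
  show "(\<integral>\<^sup>+z. f (Complex (Re z) (Im z + t * Re z)) \<partial>lborel) = (\<integral>\<^sup>+z. f z \<partial>lborel)"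
    using nn_integral_lborel_translate[of "\<lambda>y. f (Complex x y)" "t * x" for x]
    by (simp add: nn_integral_lborel_complex(2))
qed

text \<open>
  A rotation by \<open>c + \<i> s\<close> with \<open>c \<noteq> -1\<close> is a product of three shears, with parameters \<open>t\<close>, \<open>s\<close>, \<open>t\<close>
  where \<open>t = - s / (1 + c)\<close> is minus the tangent of half the angle. The remaining rotation by \<open>-1\<close> is
  the square of the rotation by \<open>\<i>\<close>.
\<close>

lemma nn_integral_complex_rotate:
  assumes [measurable]: "f \<in> borel_measurable borel" and u: "cmod u = 1"
  shows "(\<integral>\<^sup>+z. f (u * z) \<partial>lborel) = (\<integral>\<^sup>+z. f z \<partial>lborel)"
proof -
  have main: "(\<integral>\<^sup>+z. g (v * z) \<partial>lborel) = (\<integral>\<^sup>+z. g z \<partial>lborel)"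
    if v: "cmod v = 1" "v \<noteq> -1" and [measurable]: "g \<in> borel_measurable borel"
    for v and g :: "complex \<Rightarrow> ennreal"
  proof -
    define c s where "c = Re v" and "s = Im v"
    have cs: "c\<^sup>2 + s\<^sup>2 = 1" using v(1) by (simp add: c_def s_def cmod_def)
    have c: "1 + c \<noteq> 0"
    proof
      assume "1 + c = 0"
      then have "c = -1" by simp
      with cs have "s = 0" by simp
      with \<open>c = -1\<close> v(2) show False by (auto simp: c_def s_def complex_eq_iff)
    qed
    define t where "t = - s / (1 + c)"
    have t: "t * (1 + c) = - s" using c by (simp add: t_def)
    have "(1 + t * s) * (1 + c) = c * (1 + c)"
      using t cs by algebra
    then have ts: "1 + t * s = c" using c by simp
    have t2: "2 * t + s * t\<^sup>2 = - s" using t ts by algebra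
    define X where "X z = Complex (Re z + t * Im z) (Im z)" for z
    define Y where "Y z = Complex (Re z) (Im z + s * Re z)" for z
    have [measurable]: "X \<in> borel_measurable borel" "Y \<in> borel_measurable borel"
      unfolding X_def[abs_def] Y_def[abs_def] by measurable
    have "v * z = X (Y (X z))" for z
    proof -
      have "Re (X (Y (X z))) = (1 + t * s) * Re z + (2 * t + s * t\<^sup>2) * Im z"
        by (simp add: X_def Y_def algebra_simps power2_eq_square)
      moreover have "Im (X (Y (X z))) = s * Re z + (1 + t * s) * Im z"
        by (simp add: X_def Y_def algebra_simps)
      ultimately show ?thesis unfolding ts t2 by (simp add: complex_eq_iff c_def s_def)
    qed
    then have "(\<integral>\<^sup>+z. g (v * z) \<partial>lborel) = (\<integral>\<^sup>+z. g (X (Y (X z))) \<partial>lborel)" by simp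
    also have "\<dots> = (\<integral>\<^sup>+z. g (X (Y z)) \<partial>lborel)"
      using nn_integral_complex_shear(1)[of "\<lambda>z. g (X (Y z))" t] by (simp add: X_def[symmetric])
    also have "\<dots> = (\<integral>\<^sup>+z. g (X z) \<partial>lborel)"
      using nn_integral_complex_shear(2)[of "\<lambda>z. g (X z)" s] by (simp add: Y_def[symmetric])
    also have "\<dots> = (\<integral>\<^sup>+z. g z \<partial>lborel)"
      using nn_integral_complex_shear(1)[of "\<lambda>z. g z" t] by (simp add: X_def[symmetric])
    finally show ?thesis .
  qed
  show ?thesis
  proof (cases "u = -1")
    case True
    have "(\<integral>\<^sup>+z. f (u * z) \<partial>lborel) = (\<integral>\<^sup>+z. f (\<i> * (\<i> * z)) \<partial>lborel)"
      by (simp add: True mult.assoc[symmetric])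
    also have "\<dots> = (\<integral>\<^sup>+z. f (\<i> * z) \<partial>lborel)"
      by (rule main) (auto simp: complex_eq_iff)
    also have "\<dots> = (\<integral>\<^sup>+z. f z \<partial>lborel)"
      by (rule main) (auto simp: complex_eq_iff)
    finally show ?thesis .
  qed (use main u in auto)
qed

lemma nn_integral_gaussian_real:
  fixes c :: real
  assumes "0 < c"
  shows "(\<integral>\<^sup>+x. ennreal (exp (- c * x\<^sup>2)) \<partial>lborel) = ennreal (sqrt (pi / c))"
proof -
  define \<sigma> where "\<sigma> = sqrt (1 / (2 * c))"
  have s: "0 < \<sigma>" "\<sigma>\<^sup>2 = 1 / (2 * c)" using assms by (auto simp: \<sigma>_def)
  have d: "exp (- c * x\<^sup>2) = sqrt (pi / c) * normal_density 0 \<sigma> x" for x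
    using assms by (simp add: normal_density_def s(2) real_sqrt_divide field_simps)
  have "(\<integral>\<^sup>+x. ennreal (exp (- c * x\<^sup>2)) \<partial>lborel)
      = (\<integral>\<^sup>+x. ennreal (sqrt (pi / c)) * ennreal (normal_density 0 \<sigma> x) \<partial>lborel)"
    unfolding d using assms by (simp add: ennreal_mult)
  also have "\<dots> = ennreal (sqrt (pi / c)) * (\<integral>\<^sup>+x. ennreal (normal_density 0 \<sigma> x) \<partial>lborel)"
    by (rule nn_integral_cmult) simp
  also have "(\<integral>\<^sup>+x. ennreal (normal_density 0 \<sigma> x) \<partial>lborel) = 1"
    using s by (simp add: nn_integral_eq_integral)
  finally show ?thesis by simp
qed

lemma nn_integral_gaussian_complex:
  assumes "0 < c"
  shows "(\<integral>\<^sup>+z. ennreal (exp (- c * (cmod (z - w))\<^sup>2)) \<partial>lborel) = ennreal (pi / c)"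
proof -
  have "(\<integral>\<^sup>+z. ennreal (exp (- c * (cmod (z - w))\<^sup>2)) \<partial>lborel)
      = (\<integral>\<^sup>+z. ennreal (exp (- c * (cmod z)\<^sup>2)) \<partial>lborel)"
    using nn_integral_lborel_translate[of "\<lambda>z. ennreal (exp (- c * (cmod z)\<^sup>2))" "-w"] by simp
  also have "\<dots> = (\<integral>\<^sup>+y. \<integral>\<^sup>+x. ennreal (exp (- c * y\<^sup>2)) * ennreal (exp (- c * x\<^sup>2)) \<partial>lborel \<partial>lborel)"
    by (subst nn_integral_lborel_complex(1))
       (simp_all add: cmod_power2 ennreal_mult[symmetric] exp_add[symmetric] algebra_simps)
  also have "\<dots> = ennreal (sqrt (pi / c)) * ennreal (sqrt (pi / c))"
    using assms by (simp add: nn_integral_cmult nn_integral_multc nn_integral_gaussian_real[OF assms, simplified])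
  also have "\<dots> = ennreal (pi / c)"
    using assms by (simp add: ennreal_mult[symmetric])
  finally show ?thesis .
qed

section \<open>The sub-mean value property with Gaussian weight\<close>

text \<open>
  Cauchy's integral formula for \<open>u \<mapsto> f (z u)\<close> on the unit circle; scaling the argument rather than the
  circle lets the path start at \<open>z\<close>.
\<close>

lemma mean_value_circle:
  fixes f :: "complex \<Rightarrow> complex"
  assumes "f holomorphic_on UNIV"
  shows "((\<lambda>t. f (z * cis (2 * pi * t))) has_integral f 0) {0..1}"
proof -
  define F where "F u = f (z * u)" for u
  have "F holomorphic_on UNIV"
    unfolding F_def using holomorphic_on_compose_gen[OF _ assms, of "\<lambda>u. z * u" UNIV]
    by (simp add: o_def holomorphic_intros)
  then have "F holomorphic_on cball 0 1" by (rule holomorphic_on_subset) simp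
  from Cauchy_integral_circlepath_simple[OF this, of 0]
  have "((\<lambda>u. F u / (u - 0)) has_contour_integral (2 * of_real pi * \<i> * F 0)) (circlepath 0 1)"
    by simp
  then have "((\<lambda>x. F (circlepath 0 1 x) / (circlepath 0 1 x - 0) *
      vector_derivative (circlepath 0 1) (at x within {0..1})) has_integral (2 * of_real pi * \<i> * F 0)) {0..1}"
    unfolding has_contour_integral_def .
  then have "((\<lambda>x. (2 * of_real pi * \<i>) * F (cis (2 * pi * x))) has_integral (2 * of_real pi * \<i> * F 0)) {0..1}"
  proof (rule has_integral_eq[rotated])
    fix x :: real assume "x \<in> {0..1}"
    then have v: "vector_derivative (circlepath 0 1) (at x within {0..1}) = 2 * of_real pi * \<i> * cis (2 * pi * x)"
      using vector_derivative_circlepath01[of x 0 1] by (simp add: cis_conv_exp mult_ac)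
    have c: "circlepath 0 1 x = cis (2 * pi * x)" by (simp add: circlepath cis_conv_exp mult_ac)
    show "F (circlepath 0 1 x) / (circlepath 0 1 x - 0) * vector_derivative (circlepath 0 1) (at x within {0..1})
       = (2 * of_real pi * \<i>) * F (cis (2 * pi * x))"
      unfolding v c by simp
  qed
  from has_integral_mult_right[OF this, of "inverse (2 * of_real pi * \<i>)"]
  have "((\<lambda>x. F (cis (2 * pi * x))) has_integral F 0) {0..1}"
    by (simp add: field_simps)
  then show ?thesis by (simp add: F_def)
qed

lemma mean_value_powr_ge:
  fixes f :: "complex \<Rightarrow> complex"
  assumes f: "f holomorphic_on UNIV" and r: "1 \<le> r"
  shows "cmod (f 0) powr r \<le> integral {0..1} (\<lambda>t. cmod (f (z * cis (2 * pi * t))) powr r)"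
proof -
  define g where "g t = f (z * cis (2 * pi * t))" for t
  have cg: "continuous_on {0..1} g"
    unfolding g_def cis_conv_exp
    by (rule continuous_on_compose2[OF holomorphic_on_imp_continuous_on[OF f]])
       (auto intro!: continuous_intros)
  have in1: "(\<lambda>t. cmod (g t)) integrable_on {0..1}"
    by (intro integrable_continuous_interval continuous_intros cg)
  have in2: "(\<lambda>t. cmod (g t) powr r) integrable_on {0..1}"
    using r by (intro integrable_continuous_interval continuous_on_powr' continuous_intros cg) auto
  define b where "b = cmod (f 0)"
  have "b powr r \<le> integral {0..1} (\<lambda>t. cmod (g t) powr r)"
  proof (cases "b = 0")
    case True
    then show ?thesis by (simp add: integral_nonneg[OF in2])
  next
    case False
    then have b: "0 < b" by (simp add: b_def)
  have "b = norm (integral {0..1} g)"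
    using integral_unique[OF mean_value_circle[OF f, of z]] by (simp add: b_def g_def[abs_def])
  also have "\<dots> \<le> integral {0..1} (\<lambda>t. cmod (g t))"
    by (rule integral_norm_bound_integral)
       (use in1 integrable_continuous_interval[OF cg] in auto)
  finally have "0 \<le> r * b powr (r - 1) * (integral {0..1} (\<lambda>t. cmod (g t)) - b)"
    using r by simp
  also have "r * b powr (r - 1) * (integral {0..1} (\<lambda>t. cmod (g t)) - b) + b powr r
     = integral {0..1} (\<lambda>t. b powr r + r * b powr (r - 1) * (cmod (g t) - b))"
  proof -
    have "((\<lambda>t. b powr r + r * b powr (r - 1) * (cmod (g t) - b)) has_integral
       (1 - 0) *\<^sub>R (b powr r) + r * b powr (r - 1) * (integral {0..1} (\<lambda>t. cmod (g t)) - (1 - 0) *\<^sub>R b)) {0..1}"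
      by (intro has_integral_add has_integral_mult_right has_integral_diff integrable_integral[OF in1])
         (use has_integral_const_real[of "_::real" 0 1] in \<open>simp_all\<close>)
    then show ?thesis by (simp add: integral_unique)
  qed
  moreover have "\<dots> \<le> integral {0..1} (\<lambda>t. cmod (g t) powr r)"
    using b r by (intro integral_le in2 powr_above_tangent integrable_continuous_interval continuous_intros cg) auto
  ultimately show ?thesis by simp
  qed
  then show ?thesis by (simp add: b_def g_def)
qed

text \<open>
  The right-hand side does not change when \<open>f\<close> is rotated, hence equals its average over all rotations.
  After exchanging the integrals, the average over rotations is a mean over circles about \<open>0\<close>,
  which dominates the value at the centre. This replaces polar coordinates.
\<close>

lemma nn_integral_radial_powr_ge:
  fixes f :: "complex \<Rightarrow> complex" and g :: "complex \<Rightarrow> real"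
  assumes f: "f holomorphic_on UNIV" and r: "1 \<le> r"
    and g[measurable]: "g \<in> borel_measurable borel" and g0: "\<And>z. 0 \<le> g z"
    and radial: "\<And>z u. cmod u = 1 \<Longrightarrow> g (u * z) = g z"
  shows "ennreal (cmod (f 0) powr r) * (\<integral>\<^sup>+z. ennreal (g z) \<partial>lborel)
       \<le> (\<integral>\<^sup>+z. ennreal (cmod (f z) powr r * g z) \<partial>lborel)"
proof -
  have cf: "continuous_on UNIV f" using f by (rule holomorphic_on_imp_continuous_on)
  have fm[measurable]: "f \<in> borel_measurable borel" using cf by (rule borel_measurable_continuous_onI)
  have cism[measurable]: "cis \<in> borel_measurable borel"
    unfolding cis_conv_exp[abs_def] by (intro borel_measurable_continuous_onI continuous_intros)
  let ?h = "\<lambda>z t. indicator {0..1::real} t * ennreal (cmod (f (z * cis (2 * pi * t))) powr r)"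
  have "ennreal (cmod (f 0) powr r) * ennreal (g z) \<le> (\<integral>\<^sup>+t. ?h z t * ennreal (g z) \<partial>lborel)" for z
  proof -
    have c: "continuous_on {0..1} (\<lambda>t. cmod (f (z * cis (2 * pi * t))) powr r)"
      using r unfolding cis_conv_exp
      by (intro continuous_on_powr' continuous_intros continuous_on_compose2[OF cf]) auto
    have "(\<integral>\<^sup>+t. ?h z t \<partial>lborel) = ennreal (integral {0..1} (\<lambda>t. cmod (f (z * cis (2 * pi * t))) powr r))"
      using nn_integral_has_integral_lebesgue[OF _ integrable_integral[OF integrable_continuous_interval[OF c]]]
      by (simp add: ennreal_mult ennreal_indicator)
    then have "ennreal (cmod (f 0) powr r) \<le> (\<integral>\<^sup>+t. ?h z t \<partial>lborel)"
      using mean_value_powr_ge[OF f r] by (simp add: ennreal_leI)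
    then have "ennreal (cmod (f 0) powr r) * ennreal (g z) \<le> (\<integral>\<^sup>+t. ?h z t \<partial>lborel) * ennreal (g z)"
      by (rule mult_right_mono) simp
    then show ?thesis by (subst nn_integral_multc) simp_all
  qed
  then have "(\<integral>\<^sup>+z. ennreal (cmod (f 0) powr r) * ennreal (g z) \<partial>lborel)
      \<le> (\<integral>\<^sup>+z. \<integral>\<^sup>+t. ?h z t * ennreal (g z) \<partial>lborel \<partial>lborel)"
    by (intro nn_integral_mono)
  also have "\<dots> = (\<integral>\<^sup>+t. \<integral>\<^sup>+z. ?h z t * ennreal (g z) \<partial>lborel \<partial>lborel)"
    by (rule lborel_pair.Fubini'[symmetric]) simp
  also have "\<dots> = (\<integral>\<^sup>+t. indicator {0..1::real} t * (\<integral>\<^sup>+z. ennreal (cmod (f z) powr r * g z) \<partial>lborel) \<partial>lborel)"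
  proof (intro nn_integral_cong)
    fix t :: real
    have "(\<integral>\<^sup>+z. ?h z t * ennreal (g z) \<partial>lborel)
        = indicator {0..1::real} t * (\<integral>\<^sup>+z. ennreal (cmod (f (cis (2 * pi * t) * z)) powr r * g (cis (2 * pi * t) * z)) \<partial>lborel)"
    proof -
      have "?h z t * ennreal (g z) = indicator {0..1::real} t *
         ennreal (cmod (f (cis (2 * pi * t) * z)) powr r * g (cis (2 * pi * t) * z))" for z
        by (simp add: radial ennreal_mult g0 mult.commute[of z] mult.assoc)
      then show ?thesis by (simp only:) (rule nn_integral_cmult, measurable)
    qed
    also have "(\<integral>\<^sup>+z. ennreal (cmod (f (cis (2 * pi * t) * z)) powr r * g (cis (2 * pi * t) * z)) \<partial>lborel)
        = (\<integral>\<^sup>+z. ennreal (cmod (f z) powr r * g z) \<partial>lborel)"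
      by (rule nn_integral_complex_rotate[where f="\<lambda>z. ennreal (cmod (f z) powr r * g z)"]) auto
    finally show "(\<integral>\<^sup>+z. ?h z t * ennreal (g z) \<partial>lborel)
        = indicator {0..1::real} t * (\<integral>\<^sup>+z. ennreal (cmod (f z) powr r * g z) \<partial>lborel)" .
  qed
  also have "\<dots> = (\<integral>\<^sup>+z. ennreal (cmod (f z) powr r * g z) \<partial>lborel)"
    by (subst nn_integral_multc) simp_all
  finally show ?thesis by (subst (asm) nn_integral_cmult) simp_all
qed

lemma norm_gauss_weighted:
  "cmod (gauss_weighted \<alpha> f z) = cmod (f z) * exp (- (\<alpha> / 2) * (cmod z)\<^sup>2)"
  by (simp add: gauss_weighted_def norm_mult)

lemma borel_measurable_gauss_weighted:
  assumes "f holomorphic_on UNIV"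
  shows "gauss_weighted \<alpha> f \<in> borel_measurable borel"
proof -
  have "f \<in> borel_measurable borel"
    using assms by (intro borel_measurable_continuous_onI holomorphic_on_imp_continuous_on)
  then show ?thesis unfolding gauss_weighted_def[abs_def] by measurable
qed

text \<open>
  The Weyl translate \<open>h \<zeta> = f (\<zeta> + w) exp (- \<alpha> \<zeta> cnj w)\<close> moves \<open>w\<close> to the origin: its weighted modulus at
  \<open>\<zeta>\<close> is that of \<open>f\<close> at \<open>\<zeta> + w\<close> up to a constant factor. At the origin the radial case applies
  with the Gaussian weight, whose total mass is \<open>2 pi / (r \<alpha>)\<close>, so point evaluation has norm at most \<open>1\<close>.
\<close>

lemma fock_point_evaluation:
  assumes f: "f holomorphic_on UNIV" and r: "1 \<le> r" and \<alpha>: "0 < \<alpha>"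
  shows "ennreal (cmod (gauss_weighted \<alpha> f w) powr r) * ennreal (2 * pi / (r * \<alpha>))
     \<le> (\<integral>\<^sup>+z. ennreal (cmod (gauss_weighted \<alpha> f z) powr r) \<partial>lborel)"
proof -
  define h where "h \<zeta> = f (\<zeta> + w) * exp (- (of_real \<alpha> * \<zeta> * cnj w))" for \<zeta>
  have hh: "h holomorphic_on UNIV"
  proof -
    have "(\<lambda>u. u + w) holomorphic_on UNIV" by (intro holomorphic_intros)
    from holomorphic_on_compose_gen[OF this f] have "(\<lambda>u. f (u + w)) holomorphic_on UNIV"
      by (simp add: o_def)
    then show ?thesis unfolding h_def by (intro holomorphic_intros)
  qed
  have [measurable]: "gauss_weighted \<alpha> f \<in> borel_measurable borel"
    by (rule borel_measurable_gauss_weighted[OF f])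
  have sq: "(cmod (\<zeta> + w))\<^sup>2 = (cmod \<zeta>)\<^sup>2 + (cmod w)\<^sup>2 + 2 * Re (\<zeta> * cnj w)" for \<zeta>
    unfolding cmod_power2 by (simp add: power2_eq_square algebra_simps)
  have gw: "cmod (gauss_weighted \<alpha> f (\<zeta> + w)) = cmod (h \<zeta>) * exp (- (\<alpha>/2) * (cmod \<zeta>)\<^sup>2) * exp (- (\<alpha>/2) * (cmod w)\<^sup>2)" for \<zeta>
  proof -
    have "cmod (h \<zeta>) * exp (- (\<alpha>/2) * (cmod \<zeta>)\<^sup>2) * exp (- (\<alpha>/2) * (cmod w)\<^sup>2)
       = cmod (f (\<zeta> + w)) * (exp (- (\<alpha> * Re (\<zeta> * cnj w))) * exp (- (\<alpha>/2) * (cmod \<zeta>)\<^sup>2) * exp (- (\<alpha>/2) * (cmod w)\<^sup>2))"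
      by (simp add: h_def norm_mult algebra_simps)
    also have "exp (- (\<alpha> * Re (\<zeta> * cnj w))) * exp (- (\<alpha>/2) * (cmod \<zeta>)\<^sup>2) * exp (- (\<alpha>/2) * (cmod w)\<^sup>2)
       = exp (- (\<alpha>/2) * (cmod (\<zeta> + w))\<^sup>2)"
      unfolding exp_add[symmetric] sq by (rule arg_cong[of _ _ exp]) (simp add: field_simps)
    finally show ?thesis by (simp add: norm_gauss_weighted)
  qed
  let ?g = "\<lambda>\<zeta>. exp (- (r * \<alpha> / 2) * (cmod \<zeta>)\<^sup>2)"
  define c where "c = exp (- (\<alpha>/2) * (cmod w)\<^sup>2)"
  have c0: "0 < c" by (simp add: c_def)
  have pw: "cmod (gauss_weighted \<alpha> f (\<zeta> + w)) powr r = c powr r * (cmod (h \<zeta>) powr r * ?g \<zeta>)" for \<zeta>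
    unfolding gw using c0 by (simp add: powr_mult c_def exp_powr_real mult_ac)
  have "ennreal (cmod (gauss_weighted \<alpha> f w) powr r) = ennreal (c powr r) * ennreal (cmod (h 0) powr r)"
    using pw[of 0] by (simp add: ennreal_mult)
  moreover have "ennreal (cmod (h 0) powr r) * ennreal (2 * pi / (r * \<alpha>))
     \<le> (\<integral>\<^sup>+\<zeta>. ennreal (cmod (h \<zeta>) powr r * ?g \<zeta>) \<partial>lborel)"
  proof -
    have "(\<integral>\<^sup>+\<zeta>. ennreal (?g \<zeta>) \<partial>lborel) = ennreal (2 * pi / (r * \<alpha>))"
      using nn_integral_gaussian_complex[of "r * \<alpha> / 2" 0] r \<alpha> by (simp add: field_simps)
    then show ?thesis
      using nn_integral_radial_powr_ge[OF hh r, of ?g] by (simp add: norm_mult)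
  qed
  ultimately have "ennreal (cmod (gauss_weighted \<alpha> f w) powr r) * ennreal (2 * pi / (r * \<alpha>))
    \<le> ennreal (c powr r) * (\<integral>\<^sup>+\<zeta>. ennreal (cmod (h \<zeta>) powr r * ?g \<zeta>) \<partial>lborel)"
    by (simp add: mult.assoc mult_left_mono)
  also have "\<dots> = (\<integral>\<^sup>+\<zeta>. ennreal (c powr r) * ennreal (cmod (h \<zeta>) powr r * ?g \<zeta>) \<partial>lborel)"
  proof (rule nn_integral_cmult[symmetric])
    have [measurable]: "h \<in> borel_measurable borel"
      using hh by (intro borel_measurable_continuous_onI holomorphic_on_imp_continuous_on)
    show "(\<lambda>\<zeta>. ennreal (cmod (h \<zeta>) powr r * ?g \<zeta>)) \<in> borel_measurable lborel" by measurable
  qed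
  also have "\<dots> = (\<integral>\<^sup>+\<zeta>. ennreal (cmod (gauss_weighted \<alpha> f (\<zeta> + w)) powr r) \<partial>lborel)"
    unfolding pw by (simp add: ennreal_mult)
  also have "\<dots> = (\<integral>\<^sup>+z. ennreal (cmod (gauss_weighted \<alpha> f z) powr r) \<partial>lborel)"
    by (rule nn_integral_lborel_translate[where f="\<lambda>z. ennreal (cmod (gauss_weighted \<alpha> f z) powr r)"]) measurable
  finally show ?thesis .
qed

section \<open>Fock norms\<close>

text \<open>
  Membership in the Fock space of exponent \<open>p\<close> together with the norm bound \<open>C\<close>, for finite and infinite
  \<open>p\<close> alike; the factor \<open>2 pi / (p \<alpha>)\<close> undoes the normalization of the norm. The nonnegative integral makes the predicate meaningful without a prior integrability
  proof, which is what Fatou's lemma requires.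
\<close>

definition fock_le :: "real \<Rightarrow> ereal \<Rightarrow> (complex \<Rightarrow> complex) \<Rightarrow> real \<Rightarrow> bool" where
  "fock_le \<alpha> p f C \<longleftrightarrow> f holomorphic_on UNIV \<and> 0 \<le> C \<and>
     (if p = \<infinity> then \<forall>z. cmod (gauss_weighted \<alpha> f z) \<le> C
      else (\<integral>\<^sup>+z. ennreal (cmod (gauss_weighted \<alpha> f z) powr real_of_ereal p) \<partial>lborel)
         \<le> ennreal (2 * pi / (real_of_ereal p * \<alpha>) * C powr real_of_ereal p))"

lemma ereal_ge_1_cases:
  assumes "1 \<le> (p::ereal)"
  obtains "p = \<infinity>" | r where "p = ereal r" "1 \<le> r"
  using assms by (cases p) auto

lemma fock_le_infinity:
  "fock_le \<alpha> \<infinity> f C \<longleftrightarrow> f holomorphic_on UNIV \<and> 0 \<le> C \<and> (\<forall>z. cmod (gauss_weighted \<alpha> f z) \<le> C)"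
  by (simp add: fock_le_def)

lemma fock_le_ereal:
  "fock_le \<alpha> (ereal r) f C \<longleftrightarrow> f holomorphic_on UNIV \<and> 0 \<le> C \<and>
     (\<integral>\<^sup>+z. ennreal (cmod (gauss_weighted \<alpha> f z) powr r) \<partial>lborel) \<le> ennreal (2 * pi / (r * \<alpha>) * C powr r)"
  by (simp add: fock_le_def)

lemma fock_le_mono:
  assumes \<alpha>: "0 < \<alpha>" and p: "1 \<le> p" and le: "fock_le \<alpha> p f C" and CD: "C \<le> D"
  shows "fock_le \<alpha> p f D"
  using p
proof (cases rule: ereal_ge_1_cases)
  case 1
  then show ?thesis using le CD by (auto simp: fock_le_infinity intro: order_trans)
next
  case (2 r)
  have C: "0 \<le> C" using le by (simp add: fock_le_def)
  have "C powr r \<le> D powr r" by (rule powr_mono2[OF _ C CD]) (use 2 in simp)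
  then have "ennreal (2 * pi / (r * \<alpha>) * C powr r) \<le> ennreal (2 * pi / (r * \<alpha>) * D powr r)"
    using 2 \<alpha> by (intro ennreal_leI mult_left_mono) auto
  then show ?thesis using le C CD unfolding 2(1) fock_le_ereal by (auto intro: order_trans)
qed

lemma fock_le_imp:
  assumes \<alpha>: "0 < \<alpha>" and p: "1 \<le> p" and le: "fock_le \<alpha> p f C"
  shows "f \<in> fock_set \<alpha> p" "fock_norm \<alpha> p f \<le> C"
proof -
  have "f \<in> fock_set \<alpha> p \<and> fock_norm \<alpha> p f \<le> C"
    using p
  proof (cases rule: ereal_ge_1_cases)
    case 1
    have "(SUP z. cmod (gauss_weighted \<alpha> f z)) \<le> C"
      using le 1 by (intro cSUP_least) (auto simp: fock_le_infinity)
    moreover have "bdd_above (range (\<lambda>z. cmod (gauss_weighted \<alpha> f z)))"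
      using le 1 by (intro bdd_aboveI2[where M=C]) (auto simp: fock_le_infinity)
    ultimately show ?thesis
      using le 1 by (simp add: fock_le_infinity fock_set_def fock_norm_def)
  next
    case (2 r)
    define G where "G z = cmod (gauss_weighted \<alpha> f z) powr r" for z
    have f: "f holomorphic_on UNIV" and C: "0 \<le> C"
      and I: "(\<integral>\<^sup>+z. ennreal (G z) \<partial>lborel) \<le> ennreal (2 * pi / (r * \<alpha>) * C powr r)"
      using le 2 by (auto simp: fock_le_ereal G_def)
    have [measurable]: "gauss_weighted \<alpha> f \<in> borel_measurable borel"
      by (rule borel_measurable_gauss_weighted[OF f])
    have [measurable]: "G \<in> borel_measurable borel" unfolding G_def[abs_def] by measurable
    have G0: "0 \<le> G z" for z by (simp add: G_def)
    have int: "integrable lborel G"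
      by (rule integrableI_nonneg) (use I G0 in \<open>auto intro: le_less_trans\<close>)
    have "ennreal (integral\<^sup>L lborel G) \<le> ennreal (2 * pi / (r * \<alpha>) * C powr r)"
      using I nn_integral_eq_integral[OF int] G0 by simp
    then have L: "integral\<^sup>L lborel G \<le> 2 * pi / (r * \<alpha>) * C powr r"
      using 2 \<alpha> by (subst (asm) ennreal_le_iff) auto
    have L0: "0 \<le> integral\<^sup>L lborel G" by (rule Bochner_Integration.integral_nonneg) (rule G0)
    have "r * \<alpha> / (2 * pi) * integral\<^sup>L lborel G \<le> C powr r"
      using L 2 \<alpha> by (simp add: field_simps)
    then have "(r * \<alpha> / (2 * pi) * integral\<^sup>L lborel G) powr (1 / r) \<le> (C powr r) powr (1 / r)"
      using 2 \<alpha> L0 by (intro powr_mono2) auto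
    also have "\<dots> = C" using 2 C by (simp add: powr_powr)
    finally show ?thesis using f int 2 by (simp add: fock_set_def fock_norm_def Let_def G_def[abs_def])
  qed
  then show "f \<in> fock_set \<alpha> p" "fock_norm \<alpha> p f \<le> C" by auto
qed

lemma fock_le_fock_norm:
  assumes \<alpha>: "0 < \<alpha>" and p: "1 \<le> p" and f: "f \<in> fock_set \<alpha> p"
  shows "fock_le \<alpha> p f (fock_norm \<alpha> p f)"
  using p
proof (cases rule: ereal_ge_1_cases)
  case 1
  have b: "bdd_above (range (\<lambda>z. cmod (gauss_weighted \<alpha> f z)))" and h: "f holomorphic_on UNIV"
    using f 1 by (auto simp: fock_set_def)
  have "cmod (gauss_weighted \<alpha> f z) \<le> fock_norm \<alpha> p f" for z
    unfolding fock_norm_def using 1 cSUP_upper[OF UNIV_I b, of z] by simp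
  then show ?thesis using h 1 by (auto simp: fock_le_infinity intro: order_trans[OF norm_ge_zero])
next
  case (2 r)
  define G where "G z = cmod (gauss_weighted \<alpha> f z) powr r" for z
  have int: "integrable lborel G" and h: "f holomorphic_on UNIV"
    using f 2 by (auto simp: fock_set_def G_def[abs_def])
  have G0: "0 \<le> G z" for z by (simp add: G_def)
  have L0: "0 \<le> integral\<^sup>L lborel G" by (rule Bochner_Integration.integral_nonneg) (rule G0)
  have n: "fock_norm \<alpha> p f = (r * \<alpha> / (2 * pi) * integral\<^sup>L lborel G) powr (1 / r)"
    using 2 by (simp add: fock_norm_def G_def[abs_def])
  have "fock_norm \<alpha> p f powr r = r * \<alpha> / (2 * pi) * integral\<^sup>L lborel G"
    unfolding n using 2 \<alpha> L0 by (simp add: powr_powr)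
  then have "2 * pi / (r * \<alpha>) * fock_norm \<alpha> p f powr r = integral\<^sup>L lborel G"
    using 2 \<alpha> by simp
  moreover have "0 \<le> fock_norm \<alpha> p f" unfolding n by simp
  moreover have "(\<integral>\<^sup>+z. ennreal (G z) \<partial>lborel) = ennreal (integral\<^sup>L lborel G)"
    using G0 by (intro nn_integral_eq_integral int) auto
  ultimately show ?thesis using h 2 by (simp add: fock_le_ereal G_def)
qed

lemma fock_le_point:
  assumes \<alpha>: "0 < \<alpha>" and p: "1 \<le> p" and le: "fock_le \<alpha> p f C"
  shows "cmod (gauss_weighted \<alpha> f w) \<le> C"
  using p
proof (cases rule: ereal_ge_1_cases)
  case 1
  then show ?thesis using le by (simp add: fock_le_infinity)
next
  case (2 r)
  have h: "f holomorphic_on UNIV" and C: "0 \<le> C" using le 2 by (auto simp: fock_le_ereal)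
  define k where "k = 2 * pi / (r * \<alpha>)"
  let ?x = "cmod (gauss_weighted \<alpha> f w)"
  have k: "0 < k" using 2 \<alpha> by (simp add: k_def)
  have "ennreal (?x powr r) * ennreal k \<le> ennreal (k * C powr r)"
    using fock_point_evaluation[OF h 2(2) \<alpha>] le unfolding 2(1) fock_le_ereal k_def by (meson order_trans)
  then have "ennreal (?x powr r * k) \<le> ennreal (k * C powr r)"
    using k by (simp add: ennreal_mult)
  then have "?x powr r * k \<le> k * C powr r"
    using k by (subst (asm) ennreal_le_iff) auto
  then have le_powr: "?x powr r \<le> C powr r" using k by (simp add: mult.commute)
  have "(?x powr r) powr (1/r) \<le> (C powr r) powr (1/r)"
    by (rule powr_mono2[OF _ _ le_powr]) (use 2 in auto)
  moreover have "(x powr r) powr (1/r) = x" if "0 \<le> x" for x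
    using 2 that by (simp add: powr_powr)
  ultimately show ?thesis using C by (simp only: norm_ge_zero)
qed

lemma gauss_weighted_fscale: "gauss_weighted \<alpha> (fscale c f) z = c * gauss_weighted \<alpha> f z"
  by (simp add: gauss_weighted_def fscale_def)

lemma gauss_weighted_add: "gauss_weighted \<alpha> (f + g) z = gauss_weighted \<alpha> f z + gauss_weighted \<alpha> g z"
  by (simp add: gauss_weighted_def algebra_simps)

lemma fock_le_fscale:
  assumes \<alpha>: "0 < \<alpha>" and p: "1 \<le> p" and le: "fock_le \<alpha> p f C"
  shows "fock_le \<alpha> p (fscale c f) (cmod c * C)"
proof -
  have h: "fscale c f holomorphic_on UNIV"
    using le unfolding fock_le_def fscale_def by (auto intro!: holomorphic_intros)
  show ?thesis
    using p
  proof (cases rule: ereal_ge_1_cases)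
    case 1
    then show ?thesis using le h
      by (auto simp: fock_le_infinity gauss_weighted_fscale norm_mult intro!: mult_left_mono)
  next
    case (2 r)
    have f: "f holomorphic_on UNIV" and C: "0 \<le> C" using le 2 by (auto simp: fock_le_ereal)
    have [measurable]: "gauss_weighted \<alpha> f \<in> borel_measurable borel"
      by (rule borel_measurable_gauss_weighted[OF f])
    have "(\<integral>\<^sup>+z. ennreal (cmod (gauss_weighted \<alpha> (fscale c f) z) powr r) \<partial>lborel)
        = (\<integral>\<^sup>+z. ennreal (cmod c powr r) * ennreal (cmod (gauss_weighted \<alpha> f z) powr r) \<partial>lborel)"
      by (simp add: gauss_weighted_fscale norm_mult powr_mult ennreal_mult)
    also have "\<dots> = ennreal (cmod c powr r) * (\<integral>\<^sup>+z. ennreal (cmod (gauss_weighted \<alpha> f z) powr r) \<partial>lborel)"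
      by (rule nn_integral_cmult) measurable
    also have "\<dots> \<le> ennreal (cmod c powr r) * ennreal (2 * pi / (r * \<alpha>) * C powr r)"
      using le 2 by (intro mult_left_mono) (auto simp: fock_le_ereal)
    also have "\<dots> = ennreal (2 * pi / (r * \<alpha>) * (cmod c * C) powr r)"
      using 2 \<alpha> C by (simp add: ennreal_mult[symmetric] powr_mult mult_ac)
    finally show ?thesis using h C 2 by (simp add: fock_le_ereal)
  qed
qed

lemma sum_fun_apply: "sum f A x = (\<Sum>a\<in>A. f a x)" for f :: "'a \<Rightarrow> 'b \<Rightarrow> 'c::comm_monoid_add"
  by (induction A rule: infinite_finite_induct) auto

text \<open>
  The weight is bounded on discs, so the series converges locally uniformly.
\<close>

lemma holomorphic_series:
  assumes \<alpha>: "0 < \<alpha>" and h: "\<And>j. h j holomorphic_on UNIV"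
    and a: "\<And>j z. cmod (gauss_weighted \<alpha> (h j) z) \<le> a j" and s: "summable a"
    and g: "\<And>z. (\<lambda>j. h j z) sums g z"
  shows "g holomorphic_on UNIV"
proof (rule holomorphic_uniform_sequence)
  show "(\<lambda>z. \<Sum>j<n. h j z) holomorphic_on UNIV" for n
    by (intro holomorphic_on_sum h)
  fix x :: complex
  define B where "B = exp (\<alpha> / 2 * (cmod x + 1)\<^sup>2)"
  have "norm (h j z) \<le> a j * B" if z: "z \<in> cball x 1" for j z
  proof -
    have "cmod z \<le> cmod x + 1"
      using z norm_triangle_ineq2[of z x] by (simp add: dist_norm norm_minus_commute)
    then have B: "exp (\<alpha> / 2 * (cmod z)\<^sup>2) \<le> B"
      unfolding B_def using \<alpha> by (simp add: power_mono mult_left_mono)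
    have "cmod (h j z) = cmod (gauss_weighted \<alpha> (h j) z) * exp (\<alpha> / 2 * (cmod z)\<^sup>2)"
      by (simp add: norm_gauss_weighted mult.assoc exp_add[symmetric])
    also have "\<dots> \<le> a j * B"
      using a[of j z] B by (intro mult_mono) (auto intro: order_trans[OF norm_ge_zero])
    finally show ?thesis .
  qed
  then have "uniform_limit (cball x 1) (\<lambda>n z. \<Sum>j<n. h j z) (\<lambda>z. \<Sum>j. h j z) sequentially"
    by (rule Weierstrass_m_test) (use s in \<open>auto intro: summable_mult2\<close>)
  moreover have "(\<Sum>j. h j z) = g z" for z using g by (simp add: sums_iff)
  ultimately show "\<exists>d>0. cball x d \<subseteq> UNIV \<and> uniform_limit (cball x d) (\<lambda>n z. \<Sum>j<n. h j z) g sequentially"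
    by (intro exI[of _ 1]) simp
qed simp

text \<open>
  The countable triangle inequality, which also serves as the completeness of the Fock spaces: a pointwise
  convergent series with summable norms has its sum in the space. For finite \<open>p\<close>, weighted
  convexity bounds the partial sums and Fatou's lemma passes to the limit. Applied to the tails of a series it
  gives convergence in norm.
\<close>

lemma fock_le_suminf:
  assumes \<alpha>: "0 < \<alpha>" and p: "1 \<le> p"
    and h: "\<And>j. fock_le \<alpha> p (h j) (a j)" and s: "summable a"
    and g: "\<And>z. (\<lambda>j. h j z) sums g z"
  shows "fock_le \<alpha> p g (\<Sum>j. a j)"
proof -
  have a0: "0 \<le> a j" and hh: "h j holomorphic_on UNIV" for j
    using h[of j] by (auto simp: fock_le_def)
  have pt: "cmod (gauss_weighted \<alpha> (h j) z) \<le> a j" for j z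
    by (rule fock_le_point[OF \<alpha> p h])
  have gh: "g holomorphic_on UNIV"
    by (rule holomorphic_series[OF \<alpha> hh pt s g])
  have S0: "0 \<le> (\<Sum>j. a j)" by (intro suminf_nonneg s a0)
  have gs: "(\<lambda>j. gauss_weighted \<alpha> (h j) z) sums gauss_weighted \<alpha> g z" for z
    unfolding gauss_weighted_def by (intro sums_mult2 g)
  have lim: "(\<lambda>n. \<Sum>j<n. gauss_weighted \<alpha> (h j) z) \<longlonglongrightarrow> gauss_weighted \<alpha> g z" for z
    using gs[of z] by (simp add: sums_def)
  have part: "cmod (\<Sum>j<n. gauss_weighted \<alpha> (h j) z) \<le> (\<Sum>j<n. cmod (gauss_weighted \<alpha> (h j) z))" for n z
    by (rule norm_sum)
  have Sn: "(\<Sum>j<n. a j) \<le> (\<Sum>j. a j)" for n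
    by (intro sum_le_suminf s) (auto simp: a0)
  show ?thesis
    using p
  proof (cases rule: ereal_ge_1_cases)
    case 1
    have "cmod (gauss_weighted \<alpha> g z) \<le> (\<Sum>j. a j)" for z
    proof (rule LIMSEQ_le_const2[OF tendsto_norm[OF lim]], intro exI allI impI)
      show "cmod (\<Sum>j<n. gauss_weighted \<alpha> (h j) z) \<le> (\<Sum>j. a j)" for n
        using order_trans[OF part[of z n] order_trans[OF sum_mono[OF pt] Sn[of n]]] .
    qed
    then show ?thesis using gh S0 1 by (simp add: fock_le_infinity)
  next
    case (2 r)
    define S where "S = (\<Sum>j. a j)"
    define k where "k = 2 * pi / (r * \<alpha>)"
    have k: "0 < k" using 2 \<alpha> by (simp add: k_def)
    define b where "b j z = cmod (gauss_weighted \<alpha> (h j) z)" for j z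
    have bm[measurable]: "b j \<in> borel_measurable borel" for j
      unfolding b_def[abs_def] using borel_measurable_gauss_weighted[OF hh] by measurable
    have b0: "a j = 0 \<Longrightarrow> b j z = 0" for j z using pt[of j z] by (simp add: b_def)
    have part_int: "(\<integral>\<^sup>+z. ennreal ((\<Sum>j<n. b j z) powr r) \<partial>lborel) \<le> ennreal (k * S powr r)" for n
    proof -
      define A where "A = (\<Sum>j<n. a j)"
      have A0: "0 \<le> A" unfolding A_def by (intro sum_nonneg a0)
      have "(\<integral>\<^sup>+z. ennreal ((\<Sum>j<n. b j z) powr r) \<partial>lborel)
         \<le> (\<integral>\<^sup>+z. ennreal (A powr (r - 1)) * (\<Sum>j<n. ennreal (a j powr (1 - r)) * ennreal (b j z powr r)) \<partial>lborel)"
      proof (rule nn_integral_mono)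
        fix z
        have "(\<Sum>j<n. b j z) powr r \<le> A powr (r - 1) * (\<Sum>j<n. a j powr (1 - r) * b j z powr r)"
          unfolding A_def by (rule powr_sum_le_weighted) (use 2 a0 b0 in \<open>auto simp: b_def\<close>)
        then show "ennreal ((\<Sum>j<n. b j z) powr r)
            \<le> ennreal (A powr (r - 1)) * (\<Sum>j<n. ennreal (a j powr (1 - r)) * ennreal (b j z powr r))"
          by (simp add: ennreal_mult[symmetric] sum_ennreal sum_nonneg ennreal_leI)
      qed
      also have "\<dots> = ennreal (A powr (r - 1)) * (\<Sum>j<n. ennreal (a j powr (1 - r)) * (\<integral>\<^sup>+z. ennreal (b j z powr r) \<partial>lborel))"
        by (simp add: nn_integral_cmult nn_integral_sum)
      also have "\<dots> \<le> ennreal (A powr (r - 1)) * (\<Sum>j<n. ennreal (a j powr (1 - r)) * ennreal (k * a j powr r))"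
        using h unfolding 2(1) fock_le_ereal
        by (intro mult_left_mono sum_mono) (auto simp: k_def b_def)
      also have "\<dots> = ennreal (A powr (r - 1) * (\<Sum>j<n. a j powr (1 - r) * (k * a j powr r)))"
        using k by (simp add: ennreal_mult[symmetric] sum_ennreal sum_nonneg)
      also have "(\<Sum>j<n. a j powr (1 - r) * (k * a j powr r)) = k * A"
      proof -
        have "a j powr (1 - r) * (k * a j powr r) = k * a j" for j
          using a0[of j] by (cases "a j = 0") (simp_all add: powr_diff)
        then show ?thesis by (simp only: A_def sum_distrib_left)
      qed
      also have "A powr (r - 1) * (k * A) = k * A powr r"
        using A0 by (cases "A = 0") (simp_all add: powr_diff)
      also have "ennreal \<dots> \<le> ennreal (k * S powr r)"
        using k 2 A0 Sn[of n] by (intro ennreal_leI mult_left_mono powr_mono2) (auto simp: A_def S_def)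
      finally show ?thesis .
    qed
    have gm: "(\<lambda>z. \<Sum>j<n. gauss_weighted \<alpha> (h j) z) \<in> borel_measurable borel" for n
      by (intro borel_measurable_sum borel_measurable_gauss_weighted hh)
    have "(\<integral>\<^sup>+z. ennreal (cmod (gauss_weighted \<alpha> g z) powr r) \<partial>lborel)
        = (\<integral>\<^sup>+z. liminf (\<lambda>n. ennreal (cmod (\<Sum>j<n. gauss_weighted \<alpha> (h j) z) powr r)) \<partial>lborel)"
    proof (rule nn_integral_cong)
      fix z
      have "(\<lambda>n. ennreal (cmod (\<Sum>j<n. gauss_weighted \<alpha> (h j) z) powr r)) \<longlonglongrightarrow> ennreal (cmod (gauss_weighted \<alpha> g z) powr r)"
        using 2 by (intro tendsto_ennrealI tendsto_powr2 tendsto_norm[OF lim] tendsto_const) auto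
      then show "ennreal (cmod (gauss_weighted \<alpha> g z) powr r) = liminf (\<lambda>n. ennreal (cmod (\<Sum>j<n. gauss_weighted \<alpha> (h j) z) powr r))"
        by (intro lim_imp_Liminf[symmetric]) auto
    qed
    also have "\<dots> \<le> liminf (\<lambda>n. \<integral>\<^sup>+z. ennreal (cmod (\<Sum>j<n. gauss_weighted \<alpha> (h j) z) powr r) \<partial>lborel)"
      by (rule nn_integral_liminf) (use gm in measurable)
    also have "\<dots> \<le> liminf (\<lambda>n::nat. ennreal (k * S powr r))"
    proof (rule Liminf_mono, rule always_eventually, rule allI)
      fix n
      have "(\<integral>\<^sup>+z. ennreal (cmod (\<Sum>j<n. gauss_weighted \<alpha> (h j) z) powr r) \<partial>lborel)
         \<le> (\<integral>\<^sup>+z. ennreal ((\<Sum>j<n. b j z) powr r) \<partial>lborel)"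
        using part[of _ n] 2 by (intro nn_integral_mono ennreal_leI powr_mono2) (auto simp: b_def)
      then show "(\<integral>\<^sup>+z. ennreal (cmod (\<Sum>j<n. gauss_weighted \<alpha> (h j) z) powr r) \<partial>lborel) \<le> ennreal (k * S powr r)"
        using part_int[of n] by (rule order_trans)
    qed
    also have "\<dots> = ennreal (k * S powr r)" by (rule Liminf_const) simp
    finally show ?thesis using gh S0 2 by (simp add: fock_le_ereal k_def S_def)
  qed
qed

text \<open>
  The exact bound is \<open>K powr (1 / r) * M\<close>; the cruder \<open>K * M\<close> serves all exponents simultaneously. With
  \<open>K = 1\<close> the normalized kernels get norm at most \<open>1\<close>, and \<open>K = 2\<close> leaves half of the Gaussian decay to
  absorb the exponential growth of their differences.
\<close>

lemma fock_le_gaussian: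
  assumes \<alpha>: "0 < \<alpha>" and p: "1 \<le> p" and h: "f holomorphic_on UNIV" and K: "1 \<le> K" and M: "0 \<le> M"
    and b: "\<And>z. cmod (gauss_weighted \<alpha> f z) \<le> M * exp (- (\<alpha> / (2 * K)) * (cmod (z - w))\<^sup>2)"
  shows "fock_le \<alpha> p f (K * M)"
  using p
proof (cases rule: ereal_ge_1_cases)
  case 1
  have "cmod (gauss_weighted \<alpha> f z) \<le> K * M" for z
  proof -
    have "M * exp (- (\<alpha> / (2 * K)) * (cmod (z - w))\<^sup>2) \<le> M * 1"
      using M \<alpha> K by (intro mult_left_mono) auto
    also have "M * 1 \<le> K * M" using K M by (simp add: mult_le_cancel_right1)
    finally show ?thesis using b[of z] by linarith
  qed
  then show ?thesis using h K M 1 by (simp add: fock_le_infinity)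
next
  case (2 r)
  define c where "c = r * \<alpha> / (2 * K)"
  have c: "0 < c" using 2 \<alpha> K by (simp add: c_def)
  have "(\<integral>\<^sup>+z. ennreal (cmod (gauss_weighted \<alpha> f z) powr r) \<partial>lborel)
     \<le> (\<integral>\<^sup>+z. ennreal (M powr r) * ennreal (exp (- c * (cmod (z - w))\<^sup>2)) \<partial>lborel)"
  proof (rule nn_integral_mono)
    fix z
    have "cmod (gauss_weighted \<alpha> f z) powr r \<le> (M * exp (- (\<alpha> / (2 * K)) * (cmod (z - w))\<^sup>2)) powr r"
      using b[of z] 2 by (intro powr_mono2) auto
    also have "\<dots> = M powr r * exp (- c * (cmod (z - w))\<^sup>2)"
      using M by (simp add: powr_mult exp_powr_real c_def mult_ac)
    finally show "ennreal (cmod (gauss_weighted \<alpha> f z) powr r) \<le> ennreal (M powr r) * ennreal (exp (- c * (cmod (z - w))\<^sup>2))"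
      by (simp add: ennreal_mult[symmetric] ennreal_leI)
  qed
  also have "\<dots> = ennreal (M powr r) * ennreal (pi / c)"
    by (subst nn_integral_cmult) (simp_all add: nn_integral_gaussian_complex[OF c, simplified])
  also have "\<dots> = ennreal (2 * pi / (r * \<alpha>) * (K * M powr r))"
  proof -
    have "ennreal (M powr r) * ennreal (pi / c) = ennreal (M powr r * (pi / c))"
      using c by (intro ennreal_mult[symmetric]) auto
    also have "M powr r * (pi / c) = 2 * pi / (r * \<alpha>) * (K * M powr r)"
      by (simp add: c_def mult_ac)
    finally show ?thesis .
  qed
  also have "\<dots> \<le> ennreal (2 * pi / (r * \<alpha>) * (K * M) powr r)"
  proof (intro ennreal_leI mult_left_mono)
    have "K powr 1 \<le> K powr r" using K 2 by (intro powr_mono) auto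
    then have "K * M powr r \<le> K powr r * M powr r" using K by (intro mult_right_mono) auto
    then show "K * M powr r \<le> (K * M) powr r" using K M by (simp add: powr_mult)
  qed (use 2 \<alpha> in simp)
  finally show ?thesis using h K M 2 by (simp add: fock_le_ereal)
qed

section \<open>Reproducing kernels and evaluation functionals\<close>

text \<open>
  The reproducing kernel at \<open>w\<close> divided by its norm \<open>exp (\<alpha> \<bar>w\<bar>\<^sup>2 / 2)\<close>.
\<close>

definition normalized_kernel :: "real \<Rightarrow> complex \<Rightarrow> complex \<Rightarrow> complex" where
  "normalized_kernel \<alpha> w = (\<lambda>z. exp (of_real \<alpha> * z * cnj w - of_real (\<alpha> / 2 * (cmod w)\<^sup>2)))"

lemma normalized_kernel_holomorphic: "normalized_kernel \<alpha> w holomorphic_on UNIV"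
  unfolding normalized_kernel_def by (intro holomorphic_intros)

text \<open>
  The weighted modulus of the normalized kernel is a translated Gaussian, so all its Fock norms are equal to
  \<open>1\<close>.
\<close>

lemma norm_gauss_weighted_normalized_kernel:
  "cmod (gauss_weighted \<alpha> (normalized_kernel \<alpha> w) z) = exp (- (\<alpha> / 2) * (cmod (z - w))\<^sup>2)"
proof -
  have sq: "(cmod (z - w))\<^sup>2 = (cmod z)\<^sup>2 + (cmod w)\<^sup>2 - 2 * Re (z * cnj w)"
    unfolding cmod_power2 by (simp add: power2_eq_square algebra_simps)
  have "cmod (gauss_weighted \<alpha> (normalized_kernel \<alpha> w) z)
      = exp (\<alpha> * Re (z * cnj w) - \<alpha> / 2 * (cmod w)\<^sup>2 + - (\<alpha> / 2) * (cmod z)\<^sup>2)"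
    unfolding norm_gauss_weighted normalized_kernel_def norm_exp_eq_Re exp_add
    by (simp add: algebra_simps)
  also have "\<alpha> * Re (z * cnj w) - \<alpha> / 2 * (cmod w)\<^sup>2 + - (\<alpha> / 2) * (cmod z)\<^sup>2 = - (\<alpha> / 2) * (cmod (z - w))\<^sup>2"
    unfolding sq by (simp add: field_simps)
  finally show ?thesis .
qed

lemma fock_kernel_eq_normalized:
  "(\<lambda>w. fock_kernel \<alpha> w z) = fscale (of_real (exp (\<alpha> / 2 * (cmod z)\<^sup>2))) (normalized_kernel \<alpha> z)"
proof
  fix w
  define x where "x = \<alpha> / 2 * (cmod z)\<^sup>2"
  have "normalized_kernel \<alpha> z w = fock_kernel \<alpha> w z / of_real (exp x)"
    unfolding normalized_kernel_def fock_kernel_def x_def[symmetric] exp_diff exp_of_real ..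
  then show "fock_kernel \<alpha> w z = fscale (of_real (exp (\<alpha> / 2 * (cmod z)\<^sup>2))) (normalized_kernel \<alpha> z) w"
    unfolding x_def[symmetric] fscale_def by simp
qed

lemma fock_le_normalized_kernel:
  assumes "0 < \<alpha>" "1 \<le> q"
  shows "fock_le \<alpha> q (normalized_kernel \<alpha> w) 1"
  using fock_le_gaussian[OF assms normalized_kernel_holomorphic, where K=1 and M=1 and w=w]
  by (simp add: norm_gauss_weighted_normalized_kernel)

lemma norm_exp_diff_le:
  fixes A B :: complex
  assumes "Re A \<le> m" "Re B \<le> m"
  shows "cmod (exp A - exp B) \<le> exp m * cmod (A - B)"
proof (rule field_differentiable_bound[where S="{z. Re z \<le> m}" and f'=exp])
  show "convex {z. Re z \<le> m}" by (rule convex_halfspace_Re_le)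
qed (use assms in \<open>auto intro!: derivative_eq_intros\<close>)

lemma abs_norm_square_diff_le:
  fixes w w' :: complex
  assumes "cmod w \<le> R" "cmod w' \<le> R"
  shows "\<bar>(cmod w)\<^sup>2 - (cmod w')\<^sup>2\<bar> \<le> 2 * R * cmod (w - w')"
proof -
  have "\<bar>(cmod w)\<^sup>2 - (cmod w')\<^sup>2\<bar> = (cmod w + cmod w') * \<bar>cmod w - cmod w'\<bar>"
    by (simp add: power2_eq_square square_diff_square_factored abs_mult)
  also have "\<dots> \<le> (2 * R) * cmod (w - w')"
    using assms norm_triangle_ineq3[of w w'] order_trans[OF norm_ge_zero assms(1)]
    by (intro mult_mono) auto
  finally show ?thesis .
qed

text \<open>
  The exponents of the two kernels differ by at most \<open>\<alpha> (\<bar>z\<bar> + R) \<bar>w - w'\<bar>\<close>, and both have real part at most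
  \<open>\<alpha> R \<bar>z\<bar>\<close>. The resulting factor \<open>exp ((\<alpha> R + 1) \<bar>z\<bar>)\<close> is absorbed by half of the weight at the price of
  \<open>exp ((\<alpha> R + 1)\<^sup>2 / \<alpha>)\<close>, by completing the square.
\<close>

lemma gauss_weighted_kernel_diff_le:
  assumes \<alpha>: "0 < \<alpha>" and w: "cmod w \<le> R" "cmod w' \<le> R"
  shows "cmod (gauss_weighted \<alpha> (normalized_kernel \<alpha> w - normalized_kernel \<alpha> w') z)
     \<le> (\<alpha> * exp (R + (\<alpha> * R + 1)\<^sup>2 / \<alpha>) * cmod (w - w')) * exp (- (\<alpha> / (2 * 2)) * (cmod (z - 0))\<^sup>2)"
proof -
  define A where "A w = of_real \<alpha> * z * cnj w - complex_of_real (\<alpha> / 2 * (cmod w)\<^sup>2)" for w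
  define t where "t = cmod z"
  have t: "0 \<le> t" by (simp add: t_def)
  have R: "0 \<le> R" using w(1) by (rule order_trans[OF norm_ge_zero])
  have Re: "Re (A v) \<le> \<alpha> * R * t" if "cmod v \<le> R" for v
  proof -
    have "Re (of_real \<alpha> * z * cnj v) \<le> cmod (of_real \<alpha> * z * cnj v)" by (rule complex_Re_le_cmod)
    also have "\<dots> = \<alpha> * t * cmod v" using \<alpha> by (simp add: norm_mult t_def)
    also have "\<dots> \<le> \<alpha> * t * R" using \<alpha> t that by (intro mult_left_mono) auto
    finally have "Re (of_real \<alpha> * z * cnj v) \<le> \<alpha> * t * R" .
    moreover have "0 \<le> \<alpha> / 2 * (cmod v)\<^sup>2" using \<alpha> by simp
    moreover have "Re (A v) = Re (of_real \<alpha> * z * cnj v) - \<alpha> / 2 * (cmod v)\<^sup>2"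
      unfolding A_def minus_complex.sel Re_complex_of_real ..
    ultimately show ?thesis by (simp add: mult_ac)
  qed
  have "A w - A w' = of_real \<alpha> * z * cnj (w - w') - of_real (\<alpha> / 2 * ((cmod w)\<^sup>2 - (cmod w')\<^sup>2))"
    by (simp add: A_def algebra_simps)
  then have "cmod (A w - A w') \<le> cmod (of_real \<alpha> * z * cnj (w - w')) + cmod (of_real (\<alpha> / 2 * ((cmod w)\<^sup>2 - (cmod w')\<^sup>2)))"
    by (metis norm_triangle_ineq4)
  also have "cmod (of_real \<alpha> * z * cnj (w - w')) = \<alpha> * t * cmod (w - w')"
    using \<alpha> unfolding norm_mult complex_mod_cnj by (simp add: t_def)
  also have "cmod (of_real (\<alpha> / 2 * ((cmod w)\<^sup>2 - (cmod w')\<^sup>2))) = \<alpha> / 2 * \<bar>(cmod w)\<^sup>2 - (cmod w')\<^sup>2\<bar>"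
    using \<alpha> unfolding norm_of_real by (simp add: abs_mult)
  also have "\<dots> \<le> \<alpha> / 2 * (2 * R * cmod (w - w'))"
    using \<alpha> by (intro mult_left_mono abs_norm_square_diff_le w) auto
  finally have "cmod (A w - A w') \<le> \<alpha> * (t + R) * cmod (w - w')"
    by (simp add: algebra_simps)
  also have "\<dots> \<le> \<alpha> * exp (t + R) * cmod (w - w')"
  proof (intro mult_right_mono mult_left_mono)
    show "t + R \<le> exp (t + R)" using exp_ge_add_one_self[of "t + R"] by linarith
  qed (use \<alpha> in auto)
  finally have AB: "cmod (A w - A w') \<le> \<alpha> * exp (t + R) * cmod (w - w')" .
  have "cmod (gauss_weighted \<alpha> (normalized_kernel \<alpha> w - normalized_kernel \<alpha> w') z)
      = cmod (exp (A w) - exp (A w')) * exp (- (\<alpha> / 2) * t\<^sup>2)"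
    by (simp add: norm_gauss_weighted normalized_kernel_def A_def t_def)
  also have "\<dots> \<le> exp (\<alpha> * R * t) * (\<alpha> * exp (t + R) * cmod (w - w')) * exp (- (\<alpha> / 2) * t\<^sup>2)"
    using norm_exp_diff_le[OF Re[OF w(1)] Re[OF w(2)]] AB
    by (intro mult_right_mono order_trans[OF _ mult_left_mono[OF AB]]) auto
  also have "\<dots> = \<alpha> * cmod (w - w') * exp (\<alpha> * R * t + (t + R) + - (\<alpha> / 2) * t\<^sup>2)"
    unfolding exp_add by (simp add: mult_ac)
  also have "\<dots> \<le> \<alpha> * cmod (w - w') * exp (R + (\<alpha> * R + 1)\<^sup>2 / \<alpha> + - (\<alpha> / (2 * 2)) * t\<^sup>2)"
  proof (intro mult_left_mono)
    have "0 \<le> (\<alpha> * t / 2 - (\<alpha> * R + 1))\<^sup>2 / \<alpha>" using \<alpha> by simp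
    also have "\<dots> = (\<alpha> / 4) * t\<^sup>2 - (\<alpha> * R + 1) * t + (\<alpha> * R + 1)\<^sup>2 / \<alpha>"
      using \<alpha> by (simp add: field_simps power2_eq_square)
    finally have "(\<alpha> * R + 1) * t \<le> (\<alpha> / 4) * t\<^sup>2 + (\<alpha> * R + 1)\<^sup>2 / \<alpha>" by simp
    then show "exp (\<alpha> * R * t + (t + R) + - (\<alpha> / 2) * t\<^sup>2) \<le> exp (R + (\<alpha> * R + 1)\<^sup>2 / \<alpha> + - (\<alpha> / (2 * 2)) * t\<^sup>2)"
      by (simp add: distrib_right)
  qed (use \<alpha> in simp)
  finally show ?thesis unfolding exp_add by (simp add: t_def mult_ac)
qed

lemma fock_le_normalized_kernel_diff:
  assumes \<alpha>: "0 < \<alpha>" and q: "1 \<le> q" and w: "cmod w \<le> R" "cmod w' \<le> R"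
  shows "fock_le \<alpha> q (normalized_kernel \<alpha> w - normalized_kernel \<alpha> w')
     (2 * (\<alpha> * exp (R + (\<alpha> * R + 1)\<^sup>2 / \<alpha>) * cmod (w - w')))"
proof (rule fock_le_gaussian[OF \<alpha> q _ _ _ gauss_weighted_kernel_diff_le[OF \<alpha> w]])
  show "normalized_kernel \<alpha> w - normalized_kernel \<alpha> w' holomorphic_on UNIV"
    using holomorphic_on_diff[OF normalized_kernel_holomorphic normalized_kernel_holomorphic, of \<alpha> w \<alpha> w']
    by (simp add: fun_diff_def)
qed (use \<alpha> in auto)

lemma exp_minus_lipschitz:
  fixes x y :: real
  assumes "0 \<le> x" "0 \<le> y"
  shows "\<bar>exp (- x) - exp (- y)\<bar> \<le> \<bar>x - y\<bar>"
proof -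
  have *: "exp (- x) - exp (- y) \<le> y - x" "exp (- y) \<le> exp (- x)" if "0 \<le> x" "x \<le> y" for x y :: real
  proof -
    have "exp (- x) - exp (- y) = exp (- x) * (1 - exp (- (y - x)))"
      by (simp add: right_diff_distrib exp_add[symmetric])
    also have "\<dots> \<le> 1 * (y - x)"
    proof (intro mult_mono)
      show "1 - exp (- (y - x)) \<le> y - x" using exp_ge_add_one_self[of "- (y - x)"] by linarith
    qed (use that in auto)
    finally show "exp (- x) - exp (- y) \<le> y - x" by simp
  qed (use that in auto)
  show ?thesis
    using *[of x y] *[of y x] assms by (cases "x \<le> y") auto
qed

lemma cSUP_nonneg_of_zero:
  assumes "0 \<in> A" "bdd_above (f ` A)" "0 \<le> f 0"
  shows "0 \<le> (SUP x\<in>A. f x :: real)"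
  using assms cSUP_upper[of 0 A f] by linarith

text \<open>
  The common features of the Fock spaces and of the little Fock space that make them admissible as domains of
  the Toeplitz operator; the essential one is that weighted point evaluations are contractions.
\<close>

locale fock_like =
  fixes \<alpha> :: real and X :: "(complex \<Rightarrow> complex) cnspace"
  assumes alpha: "0 < \<alpha>"
    and scl_eq: "scl X = fscale"
    and holo: "f \<in> carr X \<Longrightarrow> f holomorphic_on UNIV"
    and add_closed: "f \<in> carr X \<Longrightarrow> g \<in> carr X \<Longrightarrow> f + g \<in> carr X"
    and scale_closed: "f \<in> carr X \<Longrightarrow> fscale c f \<in> carr X"
    and nrm_scale: "f \<in> carr X \<Longrightarrow> nrm X (fscale c f) = cmod c * nrm X f"
    and point_le_nrm: "f \<in> carr X \<Longrightarrow> cmod (gauss_weighted \<alpha> f z) \<le> nrm X f"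
    and kernel_closed: "(\<lambda>w. fock_kernel \<alpha> w z) \<in> carr X"
begin

lemma zero_closed: "0 \<in> carr X" and nrm_zero: "nrm X 0 = 0"
proof -
  have *: "fscale 0 (\<lambda>w. fock_kernel \<alpha> w 0) = 0" by (simp add: fscale_def fun_eq_iff)
  show "0 \<in> carr X" "nrm X 0 = 0"
    using scale_closed[OF kernel_closed, of 0 0] nrm_scale[OF kernel_closed, of 0 0] unfolding * by simp_all
qed

lemma nrm_nonneg: "f \<in> carr X \<Longrightarrow> 0 \<le> nrm X f"
  using point_le_nrm[of f 0] norm_ge_zero order_trans by blast

lemma kernel_span_subset: "kernel_span \<alpha> \<subseteq> carr X"
proof -
  interpret m: module "fscale :: complex \<Rightarrow> (complex \<Rightarrow> complex) \<Rightarrow> _"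
    by standard (auto simp: fscale_def fun_eq_iff algebra_simps)
  have "m.subspace (carr X)"
    by (rule m.subspaceI) (auto intro: zero_closed add_closed scale_closed)
  then show ?thesis
    unfolding kernel_span_def by (intro m.span_minimal) (auto intro: kernel_closed)
qed

lemma dual_bdd:
  assumes "\<phi> \<in> dual X"
  shows "bdd_above ((\<lambda>f. cmod (\<phi> f)) ` {f \<in> carr X. nrm X f \<le> 1})"
proof -
  have "\<exists>C. \<forall>f\<in>carr X. cmod (\<phi> f) \<le> C * nrm X f"
    using assms by (simp add: bounded_ops_def complex_space_def)
  then obtain C where C: "\<And>f. f \<in> carr X \<Longrightarrow> cmod (\<phi> f) \<le> C * nrm X f" by blast
  have "cmod (\<phi> f) \<le> \<bar>C\<bar>" if "f \<in> carr X" "nrm X f \<le> 1" for f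
  proof -
    have "C * nrm X f \<le> \<bar>C\<bar> * 1"
      using that nrm_nonneg[of f] by (intro mult_mono) auto
    then show ?thesis using C[OF that(1)] by linarith
  qed
  then show ?thesis by (intro bdd_aboveI2[where M="\<bar>C\<bar>"]) auto
qed

lemma dual_norm_nonneg:
  assumes "\<phi> \<in> dual X" shows "0 \<le> dual_norm X \<phi>"
  unfolding op_norm_def
  by (rule cSUP_nonneg_of_zero) (use zero_closed nrm_zero dual_bdd[OF assms] in \<open>auto simp: complex_space_def\<close>)

lemma dual_norm_bound:
  assumes \<phi>: "\<phi> \<in> dual X" and f: "f \<in> carr X"
  shows "cmod (\<phi> f) \<le> dual_norm X \<phi> * nrm X f"
proof (cases "nrm X f = 0")
  case True
  obtain C where "cmod (\<phi> f) \<le> C * nrm X f"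
    using \<phi> f by (auto simp: bounded_ops_def complex_space_def)
  then show ?thesis using True by simp
next
  case False
  then have p: "0 < nrm X f" using nrm_nonneg[OF f] by linarith
  let ?g = "fscale (of_real (1 / nrm X f)) f"
  have g: "?g \<in> {f \<in> carr X. nrm X f \<le> 1}"
    using f p nrm_scale[OF f, of "of_real (1 / nrm X f)"] scale_closed[OF f] by (simp add: norm_divide)
  have "\<phi> ?g = of_real (1 / nrm X f) * \<phi> f"
    using \<phi> f by (simp add: bounded_ops_def complex_space_def scl_eq)
  then have "cmod (\<phi> f) / nrm X f = cmod (\<phi> ?g)" using p by (simp add: norm_divide norm_mult)
  also have "\<dots> \<le> dual_norm X \<phi>"
    unfolding op_norm_def using cSUP_upper[OF g dual_bdd[OF \<phi>]] by (simp add: complex_space_def)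
  finally show ?thesis using p by (simp add: field_simps)
qed

lemma dual_norm_le:
  assumes "\<And>f. f \<in> carr X \<Longrightarrow> cmod (\<phi> f) \<le> C * nrm X f" "0 \<le> C"
  shows "dual_norm X \<phi> \<le> C"
  unfolding op_norm_def
proof (rule cSUP_least)
  show "{f \<in> carr X. nrm X f \<le> 1} \<noteq> {}" using zero_closed nrm_zero by auto
  fix f assume "f \<in> {f \<in> carr X. nrm X f \<le> 1}"
  then have f: "f \<in> carr X" "nrm X f \<le> 1" by auto
  have "C * nrm X f \<le> C * 1" using f assms(2) by (intro mult_left_mono)
  then show "nrm complex_space (\<phi> f) \<le> C" using assms(1)[OF f(1)] by (simp add: complex_space_def)
qed

definition evaluation :: "complex \<Rightarrow> (complex \<Rightarrow> complex) \<Rightarrow> complex" where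
  "evaluation w f = gauss_weighted \<alpha> f w"

lemma evaluation_dual: "evaluation w \<in> dual X"
  using point_le_nrm[of _ w]
  by (auto simp: bounded_ops_def complex_space_def evaluation_def gauss_weighted_add
      gauss_weighted_fscale scl_eq intro!: exI[of _ 1])

lemma dual_diff:
  assumes "\<phi> \<in> dual X" "\<psi> \<in> dual X"
  shows "\<phi> - \<psi> \<in> dual X"
proof -
  have "cmod (\<phi> f - \<psi> f) \<le> (dual_norm X \<phi> + dual_norm X \<psi>) * nrm X f" if "f \<in> carr X" for f
    using norm_triangle_ineq4[of "\<phi> f" "\<psi> f"] dual_norm_bound[OF assms(1) that] dual_norm_bound[OF assms(2) that]
    by (simp add: distrib_right)
  then have "\<exists>C. \<forall>f\<in>carr X. cmod (\<phi> f - \<psi> f) \<le> C * nrm X f" by blast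
  then show ?thesis
    using assms by (simp add: bounded_ops_def complex_space_def right_diff_distrib)
qed

lemma dual_norm_evaluation_le_1: "dual_norm X (evaluation w) \<le> 1"
  using point_le_nrm[of _ w] by (intro dual_norm_le) (auto simp: evaluation_def)

text \<open>
  Entire functions in the unit ball are uniformly bounded on discs, hence by Cauchy's estimate uniformly
  Lipschitz there; the weight is Lipschitz as well. The estimate being uniform in \<open>f\<close>, evaluation
  functionals are locally Lipschitz in the dual norm.
\<close>

lemma gauss_weighted_lipschitz:
  assumes f: "f \<in> carr X" and w: "cmod w \<le> R" "cmod w' \<le> R"
  shows "cmod (gauss_weighted \<alpha> f w - gauss_weighted \<alpha> f w')
     \<le> (exp (\<alpha> / 2 * (R + 1)\<^sup>2) + exp (\<alpha> / 2 * R\<^sup>2) * \<alpha> * R) * cmod (w - w') * nrm X f"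
proof -
  define a where "a = \<alpha> / 2"
  have a: "0 < a" using alpha by (simp add: a_def)
  define n where "n = nrm X f"
  have n: "0 \<le> n" unfolding n_def by (rule nrm_nonneg[OF f])
  have R: "0 \<le> R" using w(1) by (rule order_trans[OF norm_ge_zero])
  note h = holo[OF f]
  have growth: "cmod (f z) \<le> exp (a * S\<^sup>2) * n" if "cmod z \<le> S" for z S
  proof -
    have "cmod (f z) = exp (a * (cmod z)\<^sup>2) * cmod (gauss_weighted \<alpha> f z)"
      unfolding norm_gauss_weighted by (simp add: a_def exp_minus field_simps)
    also have "\<dots> \<le> exp (a * S\<^sup>2) * n"
      using point_le_nrm[OF f, of z] that a n
      by (intro mult_mono) (auto simp: n_def power_mono)
    finally show ?thesis .
  qed
  have d: "cmod (f w - f w') \<le> exp (a * (R + 1)\<^sup>2) * n * cmod (w - w')"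
  proof (rule field_differentiable_bound[where S="cball 0 R" and f'="deriv f"])
    fix z :: complex assume z: "z \<in> cball 0 R"
    show "(f has_field_derivative deriv f z) (at z within cball 0 R)"
      using holomorphic_derivI[OF h, of z] by (auto intro: has_field_derivative_at_within)
    have "cmod ((deriv ^^ 1) f z) \<le> fact 1 * (exp (a * (R + 1)\<^sup>2) * n) / 1 ^ 1"
    proof (rule Cauchy_inequality)
      show "f holomorphic_on ball z 1" "continuous_on (cball z 1) f"
        using h holomorphic_on_subset holomorphic_on_imp_continuous_on by blast+
      fix x :: complex assume "norm (z - x) = 1"
      then show "norm (f x) \<le> exp (a * (R + 1)\<^sup>2) * n"
        using z norm_triangle_ineq2[of x z] by (intro growth) (auto simp: norm_minus_commute)
    qed simp
    then show "cmod (deriv f z) \<le> exp (a * (R + 1)\<^sup>2) * n" by simp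
  qed (use w in auto)
  define e where "e v = exp (- (a * (cmod v)\<^sup>2))" for v
  have e: "gauss_weighted \<alpha> f v = f v * of_real (e v)" for v
    by (simp add: gauss_weighted_def e_def a_def)
  have e1: "0 \<le> e v" "e v \<le> 1" for v using a by (auto simp: e_def)
  have ed: "\<bar>e w - e w'\<bar> \<le> \<alpha> * R * cmod (w - w')"
  proof -
    have "\<bar>e w - e w'\<bar> \<le> \<bar>a * (cmod w)\<^sup>2 - a * (cmod w')\<^sup>2\<bar>"
      unfolding e_def using a by (intro exp_minus_lipschitz) auto
    also have "\<dots> = a * \<bar>(cmod w)\<^sup>2 - (cmod w')\<^sup>2\<bar>"
      using a by (simp add: right_diff_distrib[symmetric] abs_mult)
    also have "\<dots> \<le> a * (2 * R * cmod (w - w'))"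
      using a by (intro mult_left_mono abs_norm_square_diff_le w) auto
    finally show ?thesis by (simp add: a_def)
  qed
  have "gauss_weighted \<alpha> f w - gauss_weighted \<alpha> f w' = (f w - f w') * of_real (e w) + f w' * of_real (e w - e w')"
    unfolding e by (simp add: algebra_simps)
  then have "cmod (gauss_weighted \<alpha> f w - gauss_weighted \<alpha> f w')
      \<le> cmod (f w - f w') * e w + cmod (f w') * \<bar>e w - e w'\<bar>"
    using e1(1)[of w] norm_triangle_ineq[of "(f w - f w') * of_real (e w)" "f w' * of_real (e w - e w')"]
    by (simp only: norm_mult norm_of_real abs_of_nonneg)
  also have "\<dots> \<le> (exp (a * (R + 1)\<^sup>2) * n * cmod (w - w')) * 1 + (exp (a * R\<^sup>2) * n) * (\<alpha> * R * cmod (w - w'))"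
    using d e1 growth[OF w(2)] ed n by (intro add_mono mult_mono) auto
  finally show ?thesis by (simp add: a_def n_def algebra_simps)
qed

lemma dual_norm_evaluation_diff_le:
  assumes w: "cmod w \<le> R" "cmod w' \<le> R"
  shows "dual_norm X (evaluation w - evaluation w')
     \<le> (exp (\<alpha> / 2 * (R + 1)\<^sup>2) + exp (\<alpha> / 2 * R\<^sup>2) * \<alpha> * R) * cmod (w - w')"
proof (rule dual_norm_le)
  have "0 \<le> R" using w(1) by (rule order_trans[OF norm_ge_zero])
  then show "0 \<le> (exp (\<alpha> / 2 * (R + 1)\<^sup>2) + exp (\<alpha> / 2 * R\<^sup>2) * \<alpha> * R) * cmod (w - w')"
    using alpha by simp
qed (use gauss_weighted_lipschitz[OF _ w] in \<open>simp add: evaluation_def\<close>)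

end

lemma fock_norm_fscale:
  assumes \<alpha>: "0 < \<alpha>" and p: "1 \<le> p" and f: "f \<in> fock_set \<alpha> p"
  shows "fock_norm \<alpha> p (fscale c f) = cmod c * fock_norm \<alpha> p f"
proof -
  have le: "fock_norm \<alpha> p (fscale c f) \<le> cmod c * fock_norm \<alpha> p f" if "f \<in> fock_set \<alpha> p" for c f
    by (rule fock_le_imp(2)[OF \<alpha> p fock_le_fscale[OF \<alpha> p fock_le_fock_norm[OF \<alpha> p that]]])
  have cl: "fscale c f \<in> fock_set \<alpha> p"
    by (rule fock_le_imp(1)[OF \<alpha> p fock_le_fscale[OF \<alpha> p fock_le_fock_norm[OF \<alpha> p f]]])
  show ?thesis
  proof (cases "c = 0")
    case True
    have "0 \<le> fock_norm \<alpha> p (fscale c f)"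
      using fock_le_fock_norm[OF \<alpha> p cl] by (simp add: fock_le_def)
    then show ?thesis using le[OF f, of c] True by simp
  next
    case False
    have "fscale (1 / c) (fscale c f) = f" using False by (simp add: fscale_def)
    then have "fock_norm \<alpha> p f \<le> cmod (1 / c) * fock_norm \<alpha> p (fscale c f)"
      using le[OF cl, of "1 / c"] by simp
    then have "cmod c * fock_norm \<alpha> p f \<le> fock_norm \<alpha> p (fscale c f)"
      using False by (simp add: norm_divide field_simps)
    then show ?thesis using le[OF f, of c] by simp
  qed
qed

lemma fock_set_add:
  assumes \<alpha>: "0 < \<alpha>" and p: "1 \<le> p" and f: "f \<in> fock_set \<alpha> p" and g: "g \<in> fock_set \<alpha> p"
  shows "f + g \<in> fock_set \<alpha> p"
proof -
  \<comment> \<open>The two summands, continued by zeros to a series.\<close>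
  let ?h = "\<lambda>j::nat. if j = 0 then f else if j = 1 then g else fscale 0 f"
  let ?a = "\<lambda>j::nat. if j = 0 then fock_norm \<alpha> p f else if j = 1 then fock_norm \<alpha> p g else 0"
  have "fock_le \<alpha> p (?h j) (?a j)" for j
    using fock_le_fock_norm[OF \<alpha> p f] fock_le_fock_norm[OF \<alpha> p g] fock_le_fscale[OF \<alpha> p fock_le_fock_norm[OF \<alpha> p f], of 0]
    by auto
  moreover have "summable ?a" by (rule summable_finite[of "{0,1}"]) auto
  moreover have "(\<lambda>j. ?h j z) sums (f + g) z" for z
    using sums_finite[of "{0,1}" "\<lambda>j. ?h j z"] by (simp add: fscale_def)
  ultimately have "fock_le \<alpha> p (f + g) (\<Sum>j. ?a j)"
    by (rule fock_le_suminf[OF \<alpha> p])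
  then show ?thesis by (rule fock_le_imp[OF \<alpha> p])
qed

lemma fock_set_fscale:
  assumes "0 < \<alpha>" "1 \<le> p" "f \<in> fock_set \<alpha> p"
  shows "fscale c f \<in> fock_set \<alpha> p"
  by (rule fock_le_imp(1)[OF assms(1,2) fock_le_fscale[OF assms(1,2) fock_le_fock_norm[OF assms]]])

lemma kernel_in_fock_set:
  assumes "0 < \<alpha>" "1 \<le> p"
  shows "(\<lambda>w. fock_kernel \<alpha> w z) \<in> fock_set \<alpha> p"
  unfolding fock_kernel_eq_normalized
  by (rule fock_le_imp(1)[OF assms fock_le_fscale[OF assms fock_le_normalized_kernel[OF assms]]])

lemma fock_like_fock:
  assumes "0 < \<alpha>" "1 \<le> p"
  shows "fock_like \<alpha> (fock \<alpha> p)"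
proof
  show "0 < \<alpha>" "scl (fock \<alpha> p) = fscale" using assms by (simp_all add: fock_def)
  fix f g :: "complex \<Rightarrow> complex" and z c :: complex
  show "(\<lambda>w. fock_kernel \<alpha> w z) \<in> carr (fock \<alpha> p)"
    using kernel_in_fock_set[OF assms] by (simp add: fock_def)
  assume "f \<in> carr (fock \<alpha> p)"
  then have f: "f \<in> fock_set \<alpha> p" by (simp add: fock_def)
  show "f holomorphic_on UNIV" using f by (simp add: fock_set_def)
  show "fscale c f \<in> carr (fock \<alpha> p)" using fock_set_fscale[OF assms f] by (simp add: fock_def)
  show "nrm (fock \<alpha> p) (fscale c f) = cmod c * nrm (fock \<alpha> p) f"
    using fock_norm_fscale[OF assms f] by (simp add: fock_def)
  show "cmod (gauss_weighted \<alpha> f z) \<le> nrm (fock \<alpha> p) f"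
    using fock_le_point[OF assms fock_le_fock_norm[OF assms f]] by (simp add: fock_def)
  show "f + g \<in> carr (fock \<alpha> p)" if "g \<in> carr (fock \<alpha> p)"
    using fock_set_add[OF assms f, of g] that by (simp add: fock_def)
qed

lemma fock_like_little_fock:
  assumes \<alpha>: "0 < \<alpha>"
  shows "fock_like \<alpha> (little_fock \<alpha>)"
proof
  have i: "1 \<le> (\<infinity>::ereal)" by simp
  interpret F: fock_like \<alpha> "fock \<alpha> \<infinity>" by (rule fock_like_fock[OF \<alpha> i])
  show "0 < \<alpha>" "scl (little_fock \<alpha>) = fscale" using \<alpha> by (simp_all add: little_fock_def)
  fix f g :: "complex \<Rightarrow> complex" and z c :: complex
  assume f: "f \<in> carr (little_fock \<alpha>)"
  then have f': "f \<in> carr (fock \<alpha> \<infinity>)" and lf: "(gauss_weighted \<alpha> f \<longlongrightarrow> 0) at_infinity"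
    by (auto simp: little_fock_def fock_def)
  show "f holomorphic_on UNIV" using F.holo[OF f'] .
  show "fscale c f \<in> carr (little_fock \<alpha>)"
    using F.scale_closed[OF f'] tendsto_mult_right_zero[OF lf, of c]
    by (simp add: little_fock_def fock_def gauss_weighted_fscale[abs_def])
  show "nrm (little_fock \<alpha>) (fscale c f) = cmod c * nrm (little_fock \<alpha>) f"
    using F.nrm_scale[OF f'] by (simp add: little_fock_def fock_def)
  show "cmod (gauss_weighted \<alpha> f z) \<le> nrm (little_fock \<alpha>) f"
    using F.point_le_nrm[OF f'] by (simp add: little_fock_def fock_def)
  show "f + g \<in> carr (little_fock \<alpha>)" if "g \<in> carr (little_fock \<alpha>)"
    using F.add_closed[OF f', of g] tendsto_add[OF lf, of "gauss_weighted \<alpha> g" 0] that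
    by (simp add: little_fock_def fock_def gauss_weighted_add[abs_def])
next
  fix z
  have i: "1 \<le> (\<infinity>::ereal)" by simp
  have lim: "((\<lambda>w. exp (- (\<alpha> / 2) * (cmod (w - z))\<^sup>2)) \<longlongrightarrow> 0) at_infinity"
  proof (rule filterlim_compose[OF exp_at_bot])
    have "filterlim (\<lambda>w. w - z) at_infinity at_infinity"
      using tendsto_add_filterlim_at_infinity[OF tendsto_const[of "- z"] filterlim_ident] by simp
    then have "filterlim (\<lambda>w. cmod (w - z)) at_top at_infinity"
      by (rule filterlim_at_infinity_imp_norm_at_top)
    then have "filterlim (\<lambda>w. (cmod (w - z))\<^sup>2) at_top at_infinity"
      by (intro filterlim_pow_at_top) auto
    then show "filterlim (\<lambda>w. - (\<alpha> / 2) * (cmod (w - z))\<^sup>2) at_bot at_infinity"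
      using \<alpha> by (intro filterlim_tendsto_neg_mult_at_bot[OF tendsto_const]) auto
  qed
  have "(gauss_weighted \<alpha> (normalized_kernel \<alpha> z) \<longlongrightarrow> 0) at_infinity"
    by (rule tendsto_norm_zero_cancel) (simp only: norm_gauss_weighted_normalized_kernel lim)
  then have "(gauss_weighted \<alpha> (\<lambda>w. fock_kernel \<alpha> w z) \<longlongrightarrow> 0) at_infinity"
    unfolding fock_kernel_eq_normalized gauss_weighted_fscale[abs_def] by (rule tendsto_mult_right_zero)
  then show "(\<lambda>w. fock_kernel \<alpha> w z) \<in> carr (little_fock \<alpha>)"
    using kernel_in_fock_set[OF \<alpha> i] by (simp add: little_fock_def)
qed

section \<open>Series of countably valued functions and nuclear representations\<close>

lemma has_sum_mult:
  fixes f g :: "nat \<Rightarrow> 'a::{real_normed_field, banach}"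
  assumes f: "summable (\<lambda>m. norm (f m))" "f sums a" and g: "summable (\<lambda>l. norm (g l))" "g sums b"
  shows "((\<lambda>p. f (fst p) * g (snd p)) has_sum (a * b)) (UNIV \<times> UNIV)"
proof (rule has_sum_SigmaI)
  have F: "(f has_sum a) UNIV" and G: "(g has_sum b) UNIV"
    using assms by (auto intro: norm_summable_imp_has_sum)
  show "((\<lambda>l. f (fst (m, l)) * g (snd (m, l))) has_sum (f m * b)) UNIV" for m
    using has_sum_cmult_right[OF G, of "f m"] by simp
  show "((\<lambda>m. f m * b) has_sum (a * b)) UNIV"
    by (rule has_sum_cmult_left[OF F])
  have "(\<lambda>p. norm (f (fst p) * g (snd p))) summable_on (UNIV \<times> UNIV)"
  proof (rule summable_on_SigmaI)
    have Gn: "((\<lambda>l. norm (g l)) has_sum (\<Sum>l. norm (g l))) UNIV"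
      using g(1) by (intro sums_nonneg_imp_has_sum summable_sums) auto
    show "((\<lambda>l. norm (f (fst (m, l)) * g (snd (m, l)))) has_sum (norm (f m) * (\<Sum>l. norm (g l)))) UNIV" for m
      using has_sum_cmult_right[OF Gn, of "norm (f m)"] by (simp add: norm_mult)
    have "((\<lambda>m. norm (f m)) has_sum (\<Sum>m. norm (f m))) UNIV"
      using f(1) by (intro sums_nonneg_imp_has_sum summable_sums) auto
    then show "(\<lambda>m. norm (f m) * (\<Sum>l. norm (g l))) summable_on UNIV"
      by (intro summable_on_cmult_left) (auto simp: summable_on_def)
  qed auto
  then show "(\<lambda>p. f (fst p) * g (snd p)) summable_on (UNIV \<times> UNIV)"
    by (rule abs_summable_summable)
qed

text \<open>
  A locally Lipschitz map \<open>v\<close> into a normed space is the sum of a telescoping series of measurable countably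
  valued maps. At stage \<open>m\<close> the point \<open>w\<close> is replaced by the first point of a dense sequence within the
  distance \<open>\<rho> m w\<close>, chosen so small that the values of \<open>v\<close> differ by at most \<open>\<epsilon> / 2 ^ m / 3\<close>. The first
  term has norm at most \<open>1\<close> and the later ones together at most \<open>\<epsilon>\<close>, at every point \<open>w\<close>.
  The label \<open>l m w\<close> encodes the approximating points at stages \<open>m\<close> and \<open>m - 1\<close>, which determine
  the \<open>m\<close>-th term.
\<close>

lemma simple_function_series:
  fixes v :: "complex \<Rightarrow> 's \<Rightarrow> complex" and N :: "('s \<Rightarrow> complex) \<Rightarrow> real" and C :: "'s \<Rightarrow> real"
  assumes N1: "\<And>w. N (v w) \<le> 1"
    and lip: "\<And>R. \<exists>L. \<forall>w w'. cmod w \<le> R \<longrightarrow> cmod w' \<le> R \<longrightarrow> N (v w - v w') \<le> L * cmod (w - w')"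
    and pt: "\<And>w w' s. s \<in> S \<Longrightarrow> cmod (v w s - v w' s) \<le> N (v w - v w') * C s"
    and C0: "\<And>s. s \<in> S \<Longrightarrow> 0 \<le> C s"
    and \<epsilon>: "0 < \<epsilon>"
  obtains l :: "nat \<Rightarrow> complex \<Rightarrow> nat" and g :: "nat \<Rightarrow> nat \<Rightarrow> 's \<Rightarrow> complex"
  where "\<And>m. l m \<in> borel \<rightarrow>\<^sub>M count_space UNIV"
    and "\<And>m j. g m j \<in> range v \<union> {v w - v w' | w w'. True}"
    and "\<And>m w. N (g m (l m w)) \<le> (if m = 0 then 1 else \<epsilon> * (1/2) ^ m)"
    and "\<And>s w. s \<in> S \<Longrightarrow> (\<lambda>m. g m (l m w) s) sums v w s"
proof -
  obtain L where L: "\<And>R w w'. cmod w \<le> R \<Longrightarrow> cmod w' \<le> R \<Longrightarrow> N (v w - v w') \<le> L R * cmod (w - w')"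
    using lip by metis
  obtain D :: "complex set" where D: "countable D" "\<And>X. open X \<Longrightarrow> X \<noteq> {} \<Longrightarrow> \<exists>d\<in>D. d \<in> X"
    by (rule countable_dense_setE) blast
  have Dne: "D \<noteq> {}" using D(2)[of UNIV] by auto
  define d where "d = from_nat_into D"
  have dense: "\<exists>j. dist w (d j) < e" if "0 < e" for w e
  proof -
    obtain x where "x \<in> D" "x \<in> ball w e" using D(2)[of "ball w e"] \<open>0 < e\<close> by auto
    then show ?thesis using from_nat_into_surj[OF D(1), of x] unfolding d_def by (auto simp: mem_ball)
  qed
  \<comment> \<open>All points at distance at most one from \<open>w\<close> lie in the disc of radius \<open>k w\<close>.\<close>
  define k where "k w = nat \<lceil>cmod w\<rceil> + 1" for w
  have kw: "cmod w + 1 \<le> real (k w)" for w unfolding k_def by linarith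
  have km[measurable]: "k \<in> borel \<rightarrow>\<^sub>M count_space UNIV"
    unfolding k_def[abs_def] by measurable
  define L' where "L' n = \<bar>L (real n)\<bar> + 1" for n
  have L'0: "0 < L' n" for n by (simp add: L'_def)
  have L': "N (v x - v y) \<le> L' (k w) * cmod (x - y)"
    if "dist w x < 1" "dist w y < 1" for w x y
  proof -
    have "cmod x \<le> real (k w)" "cmod y \<le> real (k w)"
      using that kw[of w] norm_triangle_ineq2[of x w] norm_triangle_ineq2[of y w]
      by (auto simp: dist_norm norm_minus_commute)
    then have "N (v x - v y) \<le> L (real (k w)) * cmod (x - y)" by (rule L)
    also have "\<dots> \<le> L' (k w) * cmod (x - y)" by (intro mult_right_mono) (auto simp: L'_def)
    finally show ?thesis .
  qed
  define \<rho> where "\<rho> m w = min 1 (\<epsilon> * (1/2) ^ m / (3 * L' (k w)))" for m w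
  have \<rho>0: "0 < \<rho> m w" for m w using \<epsilon> L'0[of "k w"] by (simp add: \<rho>_def)
  have \<rho>m[measurable]: "\<rho> m \<in> borel_measurable borel" for m
    unfolding \<rho>_def[abs_def] by measurable
  define c where "c m w = (LEAST j. dist w (d j) < \<rho> m w)" for m w
  have c: "dist w (d (c m w)) < \<rho> m w" for m w
    unfolding c_def by (rule LeastI_ex[OF dense[OF \<rho>0]])
  have c1: "dist w (d (c m w)) < 1" for m w using c[of w m] by (simp add: \<rho>_def)
  have cm[measurable]: "c m \<in> borel \<rightarrow>\<^sub>M count_space UNIV" for m
    unfolding c_def[abs_def] by measurable
  have near: "L' (k w) * dist w (d (c m w)) \<le> \<epsilon> * (1/2) ^ m / 3" for m w
  proof -
    have "dist w (d (c m w)) \<le> \<epsilon> * (1/2) ^ m / (3 * L' (k w))"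
      using c[of w m] by (simp add: \<rho>_def)
    then show ?thesis using L'0[of "k w"] by (simp add: field_simps)
  qed
  define l :: "nat \<Rightarrow> complex \<Rightarrow> nat" where "l m w = prod_encode (c m w, c (m - 1) w)" for m w
  define g :: "nat \<Rightarrow> nat \<Rightarrow> 's \<Rightarrow> complex" where "g m j = (if m = 0 then v (d (fst (prod_decode j)))
      else v (d (fst (prod_decode j))) - v (d (snd (prod_decode j))))" for m j
  have g: "g m (l m w) = (if m = 0 then v (d (c m w)) else v (d (c m w)) - v (d (c (m - 1) w)))" for m w
    by (simp add: g_def l_def)
  show thesis
  proof
    show "l m \<in> borel \<rightarrow>\<^sub>M count_space UNIV" for m
      unfolding l_def[abs_def] by measurable
    show "g m j \<in> range v \<union> {v w - v w' | w w'. True}" for m j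
      by (auto simp: g_def)
    show "N (g m (l m w)) \<le> (if m = 0 then 1 else \<epsilon> * (1/2) ^ m)" for m w
    proof (cases m)
      case 0
      then show ?thesis using N1 by (simp add: g)
    next
      case (Suc n)
      have "N (v (d (c m w)) - v (d (c n w))) \<le> L' (k w) * cmod (d (c m w) - d (c n w))"
        by (rule L'[OF c1 c1])
      also have "\<dots> \<le> L' (k w) * (dist w (d (c m w)) + dist w (d (c n w)))"
        using L'0[of "k w"] dist_triangle3[of "d (c m w)" "d (c n w)" w]
        by (intro mult_left_mono) (auto simp: dist_norm)
      also have "\<dots> \<le> \<epsilon> * (1/2) ^ m / 3 + \<epsilon> * (1/2) ^ n / 3"
        unfolding distrib_left by (intro add_mono near)
      also have "\<dots> = \<epsilon> * (1/2) ^ m" using Suc by simp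
      finally show ?thesis using Suc by (simp add: g)
    qed
    fix s w assume s: "s \<in> S"
    have part: "(\<Sum>m<Suc n. g m (l m w) s) = v (d (c n w)) s" for n
      by (induction n) (simp_all add: g)
    have bd: "cmod (v w s - v (d (c n w)) s) \<le> \<epsilon> / 3 * C s * (1/2) ^ n" for n
    proof -
      have "cmod (v w s - v (d (c n w)) s) \<le> N (v w - v (d (c n w))) * C s" by (rule pt[OF s])
      also have "\<dots> \<le> (L' (k w) * cmod (w - d (c n w))) * C s"
        using C0[OF s] by (intro mult_right_mono L'[OF _ c1]) auto
      also have "\<dots> \<le> (\<epsilon> * (1/2) ^ n / 3) * C s"
        using C0[OF s] near[of w n] by (intro mult_right_mono) (auto simp: dist_norm)
      finally show ?thesis by (simp add: mult_ac)
    qed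
    have lim0: "(\<lambda>n. \<epsilon> / 3 * C s * (1/2) ^ n) \<longlonglongrightarrow> 0"
      by (intro tendsto_mult_right_zero LIMSEQ_power_zero) simp
    have lim1: "(\<lambda>n. v w s - v (d (c n w)) s) \<longlonglongrightarrow> 0"
      by (rule Lim_null_comparison[OF always_eventually[OF allI[OF bd]] lim0])
    have "(\<lambda>n. v (d (c n w)) s) \<longlonglongrightarrow> v w s"
      using tendsto_diff[OF tendsto_const[of "v w s"] lim1] by simp
    then have "(\<lambda>n. \<Sum>m<Suc n. g m (l m w) s) \<longlonglongrightarrow> v w s" by (simp only: part)
    then show "(\<lambda>m. g m (l m w) s) sums v w s"
      unfolding sums_def by (rule LIMSEQ_imp_Suc)
  qed
qed

context fock_like
begin

text \<open>
  A pointwise identity between functions suffices: as the norms are summable, the tails tend to zero in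
  the norm of the target space.
\<close>

lemma nuclear_of_series:
  assumes q: "1 \<le> q"
    and x': "\<And>j. x' j \<in> dual X" and y: "\<And>j. y j \<in> fock_set \<alpha> q"
    and sm: "summable (\<lambda>j. dual_norm X (x' j) * fock_norm \<alpha> q (y j))"
    and T: "\<And>f z. f \<in> carr X \<Longrightarrow> (\<lambda>j. x' j f * y j z) sums T f z"
  shows "T \<in> nuclear_ops X (fock \<alpha> q)"
    and "nuclear_norm X (fock \<alpha> q) T \<le> (\<Sum>j. dual_norm X (x' j) * fock_norm \<alpha> q (y j))"
proof -
  define a where "a j = dual_norm X (x' j) * fock_norm \<alpha> q (y j)" for j
  have sa: "summable a" using sm by (simp add: a_def[abs_def])
  have Ynn: "0 \<le> fock_norm \<alpha> q h" if "h \<in> fock_set \<alpha> q" for h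
    using fock_le_fock_norm[OF alpha q that] by (simp add: fock_le_def)
  have le: "fock_le \<alpha> q (fscale (x' j f) (y j)) (a j * nrm X f)" if f: "f \<in> carr X" for j f
  proof (rule fock_le_mono[OF alpha q])
    show "fock_le \<alpha> q (fscale (x' j f) (y j)) (cmod (x' j f) * fock_norm \<alpha> q (y j))"
      by (intro fock_le_fscale alpha q fock_le_fock_norm y)
    have "cmod (x' j f) * fock_norm \<alpha> q (y j) \<le> (dual_norm X (x' j) * nrm X f) * fock_norm \<alpha> q (y j)"
      by (intro mult_right_mono dual_norm_bound x' f Ynn y)
    then show "cmod (x' j f) * fock_norm \<alpha> q (y j) \<le> a j * nrm X f" by (simp add: a_def mult_ac)
  qed
  have tail: "fock_le \<alpha> q (T f - (\<Sum>j<n. fscale (x' j f) (y j))) ((\<Sum>j. a (j + n)) * nrm X f)"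
    if f: "f \<in> carr X" for f n
  proof -
    have sn: "summable (\<lambda>j. a (j + n))" using sa by (simp add: summable_iff_shift)
    have "fock_le \<alpha> q (T f - (\<Sum>j<n. fscale (x' j f) (y j))) (\<Sum>j. a (j + n) * nrm X f)"
    proof (rule fock_le_suminf[OF alpha q])
      show "fock_le \<alpha> q (fscale (x' (j + n) f) (y (j + n))) (a (j + n) * nrm X f)" for j
        by (rule le[OF f])
      show "summable (\<lambda>j. a (j + n) * nrm X f)" using sn by (rule summable_mult2)
      show "(\<lambda>j. fscale (x' (j + n) f) (y (j + n)) z) sums (T f - (\<Sum>j<n. fscale (x' j f) (y j))) z" for z
        using sums_split_initial_segment[OF T[OF f, of z], of n] by (simp add: fscale_def sum_fun_apply)
    qed
    then show ?thesis using suminf_mult2[OF sn, of "nrm X f"] by simp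
  qed
  have Tf: "fock_le \<alpha> q (T f) ((\<Sum>j. a j) * nrm X f)" if "f \<in> carr X" for f
    using tail[OF that, of 0] by simp
  have bop: "T \<in> bounded_ops X (fock \<alpha> q)"
    unfolding bounded_ops_def
  proof (intro CollectI conjI ballI allI)
    fix f c assume f: "f \<in> carr X"
    show "T f \<in> carr (fock \<alpha> q)"
      using fock_le_imp(1)[OF alpha q Tf[OF f]] by (simp add: fock_def)
    show "T (scl X c f) = scl (fock \<alpha> q) c (T f)"
    proof
      fix z
      have "x' j (scl X c f) = c * x' j f" for j
        using x'[of j] f by (simp add: bounded_ops_def complex_space_def)
      then have "(\<lambda>j. x' j (scl X c f) * y j z) sums (c * T f z)"
        using sums_mult[OF T[OF f, of z], of c] by (simp add: mult_ac)
      moreover have "scl X c f \<in> carr X" using scale_closed[OF f] by (simp add: scl_eq)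
      ultimately show "T (scl X c f) z = scl (fock \<alpha> q) c (T f) z"
        using T[of "scl X c f" z] sums_unique2 by (auto simp: fock_def fscale_def)
    qed
  next
    fix f g assume f: "f \<in> carr X" and g: "g \<in> carr X"
    show "T (f + g) = T f + T g"
    proof
      fix z
      have "x' j (f + g) = x' j f + x' j g" for j
        using x'[of j] f g by (simp add: bounded_ops_def)
      then have "(\<lambda>j. x' j (f + g) * y j z) sums (T f z + T g z)"
        using sums_add[OF T[OF f, of z] T[OF g, of z]] by (simp add: distrib_right)
      then show "T (f + g) z = (T f + T g) z"
        using T[OF add_closed[OF f g], of z] sums_unique2 by auto
    qed
  next
    show "\<exists>C. \<forall>f\<in>carr X. nrm (fock \<alpha> q) (T f) \<le> C * nrm X f"
      using fock_le_imp(2)[OF alpha q Tf] by (auto simp: fock_def)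
  qed
  have rep: "nuclear_rep X (fock \<alpha> q) T x' y"
    unfolding nuclear_rep_def
  proof (intro conjI allI ballI x')
    show "y j \<in> carr (fock \<alpha> q)" for j using y by (simp add: fock_def)
    show "summable (\<lambda>j. dual_norm X (x' j) * nrm (fock \<alpha> q) (y j))" using sm by (simp add: fock_def)
    fix f assume f: "f \<in> carr X"
    have "(\<lambda>n. fock_norm \<alpha> q (T f - (\<Sum>j<n. fscale (x' j f) (y j)))) \<longlonglongrightarrow> 0"
    proof (rule tendsto_sandwich[OF _ _ tendsto_const])
      show "\<forall>\<^sub>F n in sequentially. 0 \<le> fock_norm \<alpha> q (T f - (\<Sum>j<n. fscale (x' j f) (y j)))"
        using Ynn[OF fock_le_imp(1)[OF alpha q tail[OF f]]] by (intro always_eventually allI)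
      show "\<forall>\<^sub>F n in sequentially. fock_norm \<alpha> q (T f - (\<Sum>j<n. fscale (x' j f) (y j))) \<le> (\<Sum>j. a (j + n)) * nrm X f"
        using fock_le_imp(2)[OF alpha q tail[OF f]] by (intro always_eventually allI)
      show "(\<lambda>n. (\<Sum>j. a (j + n)) * nrm X f) \<longlonglongrightarrow> 0"
        by (intro tendsto_mult_left_zero suminf_exist_split2 sa)
    qed
    then show "(\<lambda>n. nrm (fock \<alpha> q) (T f - (\<Sum>j<n. scl (fock \<alpha> q) (x' j f) (y j)))) \<longlonglongrightarrow> 0"
      by (simp add: fock_def)
  qed
  show "T \<in> nuclear_ops X (fock \<alpha> q)"
    unfolding nuclear_ops_def using bop rep by blast
  have nonneg: "0 \<le> (\<Sum>j. dual_norm X (x j) * nrm (fock \<alpha> q) (h j))"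
    if "nuclear_rep X (fock \<alpha> q) T x h" for x h
    using that dual_norm_nonneg Ynn unfolding nuclear_rep_def
    by (intro suminf_nonneg mult_nonneg_nonneg) (auto simp: fock_def)
  show "nuclear_norm X (fock \<alpha> q) T \<le> (\<Sum>j. dual_norm X (x' j) * fock_norm \<alpha> q (y j))"
    unfolding nuclear_norm_def
  proof (rule cInf_lower)
    show "(\<Sum>j. dual_norm X (x' j) * fock_norm \<alpha> q (y j))
        \<in> {\<Sum>j. dual_norm X (x' j) * nrm (fock \<alpha> q) (y j) |x' y. nuclear_rep X (fock \<alpha> q) T x' y}"
      using rep by (auto simp: fock_def)
    show "bdd_below {\<Sum>j. dual_norm X (x' j) * nrm (fock \<alpha> q) (y j) |x' y. nuclear_rep X (fock \<alpha> q) T x' y}"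
      by (rule bdd_belowI[of _ 0]) (use nonneg in blast)
  qed
qed

end

section \<open>Nuclearity of Toeplitz operators\<close>

text \<open>
  For a fixed \<open>w\<close>, only the indices in the range of \<open>e\<close> are active.
\<close>

lemma has_sum_indicator_reindex:
  fixes \<phi> :: "nat \<Rightarrow> 'b::{semiring_1, topological_space}" and e :: "'p \<Rightarrow> nat"
  assumes "inj e" and on: "\<And>p. w \<in> A (e p)" and off: "\<And>i. w \<in> A i \<Longrightarrow> i \<in> range e"
  shows "((\<lambda>i. indicator (A i) w * \<phi> i) has_sum s) UNIV \<longleftrightarrow> ((\<lambda>p. \<phi> (e p)) has_sum s) UNIV"
proof -
  have "((\<lambda>i. indicator (A i) w * \<phi> i) has_sum s) UNIV \<longleftrightarrow> (\<phi> has_sum s) (range e)"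
    using on off by (intro has_sum_cong_neutral) (auto simp: indicator_def)
  also have "\<dots> \<longleftrightarrow> ((\<phi> \<circ> e) has_sum s) UNIV"
    by (rule has_sum_reindex[OF assms(1)])
  finally show ?thesis by (simp add: o_def)
qed

lemma sums_geometric_budget:
  fixes \<epsilon> :: real
  shows "(\<lambda>m. if m = 0 then 1 else \<epsilon> * (1/2) ^ m) sums (1 + \<epsilon>)"
proof -
  have "(\<lambda>m. \<epsilon> * (1/2) ^ m) sums (\<epsilon> * 2)"
    using sums_mult[OF geometric_sums[of "1/2 :: real"], of \<epsilon>] by simp
  moreover have "(\<lambda>m. if m = 0 then 1 - \<epsilon> else 0) sums (1 - \<epsilon>)"
    by (rule sums_single)
  ultimately have "(\<lambda>m. \<epsilon> * (1/2) ^ m + (if m = 0 then 1 - \<epsilon> else 0)) sums (\<epsilon> * 2 + (1 - \<epsilon>))"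
    by (rule sums_add)
  moreover have "\<epsilon> * (1/2) ^ m + (if m = 0 then 1 - \<epsilon> else 0) = (if m = 0 then 1 else \<epsilon> * (1/2) ^ m)" for m :: nat
    by simp
  moreover have "\<epsilon> * 2 + (1 - \<epsilon>) = 1 + \<epsilon>" by simp
  ultimately show ?thesis by (simp only:)
qed

context fock_like
begin

text \<open>
  Half of the Gaussian factor normalizes the kernel, the other half weights \<open>f\<close>.
\<close>

lemma toeplitz_integrand:
  "fock_kernel \<alpha> z w * f w * of_real (exp (- \<alpha> * (cmod w)\<^sup>2)) = evaluation w f * normalized_kernel \<alpha> w z"
proof -
  define x where "x = \<alpha> / 2 * (cmod w)\<^sup>2"
  have "exp (- \<alpha> * (cmod w)\<^sup>2) = exp (- x) * exp (- x)"
    unfolding exp_add[symmetric] x_def by simp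
  moreover have "evaluation w f = f w * of_real (exp (- x))"
    by (simp add: evaluation_def gauss_weighted_def x_def)
  moreover have "normalized_kernel \<alpha> w z = fock_kernel \<alpha> z w * of_real (exp (- x))"
    unfolding normalized_kernel_def fock_kernel_def x_def[symmetric]
    by (simp add: exp_diff exp_minus exp_of_real divide_inverse)
  ultimately show ?thesis by (simp add: mult_ac)
qed

lemma evaluation_series:
  assumes "0 < \<epsilon>"
  obtains l :: "nat \<Rightarrow> complex \<Rightarrow> nat" and g
  where "\<And>m. l m \<in> borel \<rightarrow>\<^sub>M count_space UNIV" and "\<And>m j. g m j \<in> dual X"
    and "\<And>m w. dual_norm X (g m (l m w)) \<le> (if m = 0 then 1 else \<epsilon> * (1/2) ^ m)"
    and "\<And>f w. f \<in> carr X \<Longrightarrow> (\<lambda>m. g m (l m w) f) sums evaluation w f"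
proof (rule simple_function_series[of "dual_norm X" evaluation "carr X" "nrm X" \<epsilon>])
  show "dual_norm X (evaluation w) \<le> 1" for w by (rule dual_norm_evaluation_le_1)
  show "\<exists>L. \<forall>w w'. cmod w \<le> R \<longrightarrow> cmod w' \<le> R \<longrightarrow> dual_norm X (evaluation w - evaluation w') \<le> L * cmod (w - w')" for R
    using dual_norm_evaluation_diff_le[of _ R] by blast
  show "cmod (evaluation w f - evaluation w' f) \<le> dual_norm X (evaluation w - evaluation w') * nrm X f"
    if "f \<in> carr X" for w w' f
    using dual_norm_bound[OF dual_diff[OF evaluation_dual evaluation_dual] that, of w w'] by simp
  show "0 \<le> nrm X f" if "f \<in> carr X" for f using that by (rule nrm_nonneg)
  fix l :: "nat \<Rightarrow> complex \<Rightarrow> nat" and g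
  assume *: "\<And>m. l m \<in> borel \<rightarrow>\<^sub>M count_space UNIV"
    "\<And>m j. g m j \<in> range evaluation \<union> {evaluation w - evaluation w' |w w'. True}"
    "\<And>m w. dual_norm X (g m (l m w)) \<le> (if m = 0 then 1 else \<epsilon> * (1/2) ^ m)"
    "\<And>f w. f \<in> carr X \<Longrightarrow> (\<lambda>m. g m (l m w) f) sums evaluation w f"
  have "g m j \<in> dual X" for m j
    using *(2)[of m j] evaluation_dual dual_diff by auto
  with * show thesis using that by blast
next
  show "0 < \<epsilon>" by (rule assms)
qed

end

lemma norm_le_fock_norm:
  assumes "0 < \<alpha>" "1 \<le> q" "h \<in> fock_set \<alpha> q"
  shows "cmod (h z) \<le> fock_norm \<alpha> q h * exp (\<alpha> / 2 * (cmod z)\<^sup>2)"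
proof -
  have "cmod (h z) = cmod (gauss_weighted \<alpha> h z) * exp (\<alpha> / 2 * (cmod z)\<^sup>2)"
    by (simp add: norm_gauss_weighted mult.assoc exp_add[symmetric])
  also have "\<dots> \<le> fock_norm \<alpha> q h * exp (\<alpha> / 2 * (cmod z)\<^sup>2)"
    by (intro mult_right_mono fock_le_point[OF assms(1,2) fock_le_fock_norm[OF assms]]) simp
  finally show ?thesis .
qed

lemma normalized_kernel_series:
  assumes \<alpha>: "0 < \<alpha>" and q: "1 \<le> q" and \<epsilon>: "0 < \<epsilon>"
  obtains l :: "nat \<Rightarrow> complex \<Rightarrow> nat" and g
  where "\<And>m. l m \<in> borel \<rightarrow>\<^sub>M count_space UNIV" and "\<And>m j. g m j \<in> fock_set \<alpha> q"
    and "\<And>m w. fock_norm \<alpha> q (g m (l m w)) \<le> (if m = 0 then 1 else \<epsilon> * (1/2) ^ m)"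
    and "\<And>z w. (\<lambda>m. g m (l m w) z) sums normalized_kernel \<alpha> w z"
proof (rule simple_function_series[of "fock_norm \<alpha> q" "normalized_kernel \<alpha>" UNIV
      "\<lambda>z. exp (\<alpha> / 2 * (cmod z)\<^sup>2)" \<epsilon>])
  let ?k = "normalized_kernel \<alpha>"
  have mem: "?k w \<in> fock_set \<alpha> q" for w
    by (rule fock_le_imp(1)[OF \<alpha> q fock_le_normalized_kernel[OF \<alpha> q]])
  have dle: "fock_le \<alpha> q (?k w - ?k w') (2 * (\<alpha> * exp (R + (\<alpha> * R + 1)\<^sup>2 / \<alpha>) * cmod (w - w')))"
    if "cmod w \<le> R" "cmod w' \<le> R" for w w' R
    by (rule fock_le_normalized_kernel_diff[OF \<alpha> q that])
  have dmem: "?k w - ?k w' \<in> fock_set \<alpha> q" for w w'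
    by (rule fock_le_imp(1)[OF \<alpha> q dle[of w "max (cmod w) (cmod w')"]]) auto
  show "fock_norm \<alpha> q (?k w) \<le> 1" for w
    by (rule fock_le_imp(2)[OF \<alpha> q fock_le_normalized_kernel[OF \<alpha> q]])
  show "\<exists>L. \<forall>w w'. cmod w \<le> R \<longrightarrow> cmod w' \<le> R \<longrightarrow> fock_norm \<alpha> q (?k w - ?k w') \<le> L * cmod (w - w')" for R
    using fock_le_imp(2)[OF \<alpha> q dle[of _ R]]
    by (intro exI[of _ "2 * (\<alpha> * exp (R + (\<alpha> * R + 1)\<^sup>2 / \<alpha>))"]) (simp add: mult.assoc)
  show "cmod (?k w z - ?k w' z) \<le> fock_norm \<alpha> q (?k w - ?k w') * exp (\<alpha> / 2 * (cmod z)\<^sup>2)" for w w' z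
    using norm_le_fock_norm[OF \<alpha> q dmem[of w w'], of z] by simp
  fix l :: "nat \<Rightarrow> complex \<Rightarrow> nat" and g
  assume *: "\<And>m. l m \<in> borel \<rightarrow>\<^sub>M count_space UNIV"
    "\<And>m j. g m j \<in> range ?k \<union> {?k w - ?k w' |w w'. True}"
    "\<And>m w. fock_norm \<alpha> q (g m (l m w)) \<le> (if m = 0 then 1 else \<epsilon> * (1/2) ^ m)"
    "\<And>z w. z \<in> UNIV \<Longrightarrow> (\<lambda>m. g m (l m w) z) sums ?k w z"
  have "g m j \<in> fock_set \<alpha> q" for m j
    using *(2)[of m j] mem dmem by auto
  with * show thesis using that by blast
qed (use \<epsilon> in auto)

text \<open>
  Since \<open>\<bar>\<mu> (A i)\<bar> \<le> \<bar>\<mu>\<bar> (A i)\<close>, the sum is at most the integral of \<open>\<Sum>i. indicator (A i) w * n i\<close> against the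
  total variation measure; a pointwise budget \<open>c\<close> therefore controls it although the sets overlap.
\<close>

lemma summable_sum_le_of_var_measure:
  assumes "complex_measure borel \<mu>" "variation borel \<mu> UNIV < \<infinity>"
    and A: "\<And>i. A i \<in> sets borel" and n0: "\<And>i. 0 \<le> n i" and c0: "0 \<le> c"
    and part: "\<And>N w. (\<Sum>i<N. indicator (A i) w * n i) \<le> c"
  shows "summable (\<lambda>i. cmod (\<mu> (A i)) * n i)"
    and "(\<Sum>i. cmod (\<mu> (A i)) * n i) \<le> enn2real (variation borel \<mu> UNIV) * c"
proof -
  interpret vector_measure borel \<mu>
    using assms(1) by (simp add: complex_measure_def vector_measure_def)
  have "(\<Sum>i. ennreal (cmod (\<mu> (A i)) * n i)) \<le> (\<Sum>i. \<integral>\<^sup>+w. ennreal (n i) * indicator (A i) w \<partial>var_measure)"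
  proof (intro suminf_le)
    fix i
    have "ennreal (cmod (\<mu> (A i)) * n i) = ennreal (n i) * ennreal (cmod (\<mu> (A i)))"
      using n0[of i] by (simp add: ennreal_mult mult.commute)
    also have "\<dots> \<le> ennreal (n i) * emeasure var_measure (A i)"
      using norm_le_variation[OF A[of i]] A by (intro mult_left_mono) (simp_all add: emeasure_var_measure)
    also have "\<dots> = (\<integral>\<^sup>+w. ennreal (n i) * indicator (A i) w \<partial>var_measure)"
      using A by (intro nn_integral_cmult_indicator[symmetric]) simp
    finally show "ennreal (cmod (\<mu> (A i)) * n i) \<le> (\<integral>\<^sup>+w. ennreal (n i) * indicator (A i) w \<partial>var_measure)" .
  qed auto
  also have "\<dots> = (\<integral>\<^sup>+w. (\<Sum>i. ennreal (n i) * indicator (A i) w) \<partial>var_measure)"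
    using A by (intro nn_integral_suminf[symmetric] borel_measurable_times_ennreal borel_measurable_const borel_measurable_indicator) simp
  also have "\<dots> \<le> (\<integral>\<^sup>+w. ennreal c \<partial>var_measure)"
  proof (intro nn_integral_mono suminf_le_const)
    fix w N
    have "(\<Sum>i<N. ennreal (n i) * indicator (A i) w) = (\<Sum>i<N. ennreal (indicator (A i) w * n i))"
      by (intro sum.cong refl) (simp add: indicator_def)
    also have "\<dots> = ennreal (\<Sum>i<N. indicator (A i) w * n i)"
      using n0 by (intro sum_ennreal) simp
    also have "\<dots> \<le> ennreal c" by (intro ennreal_leI part)
    finally show "(\<Sum>i<N. ennreal (n i) * indicator (A i) w) \<le> ennreal c" .
  qed simp
  also have "\<dots> = ennreal c * variation borel \<mu> UNIV"
    by (simp add: emeasure_var_measure)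
  also have "\<dots> = ennreal (enn2real (variation borel \<mu> UNIV) * c)"
  proof -
    have "variation borel \<mu> UNIV = ennreal (enn2real (variation borel \<mu> UNIV))"
      using assms(2) by simp
    then show ?thesis using c0 by (metis enn2real_nonneg ennreal_mult mult.commute)
  qed
  finally have le: "(\<Sum>i. ennreal (cmod (\<mu> (A i)) * n i)) \<le> ennreal (enn2real (variation borel \<mu> UNIV) * c)" .
  have nn: "0 \<le> cmod (\<mu> (A i)) * n i" for i using n0 by simp
  show sm: "summable (\<lambda>i. cmod (\<mu> (A i)) * n i)"
    by (rule summable_suminf_not_top[OF nn]) (use le in \<open>metis ennreal_neq_top neq_top_trans\<close>)
  have "ennreal (\<Sum>i. cmod (\<mu> (A i)) * n i) \<le> ennreal (enn2real (variation borel \<mu> UNIV) * c)"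
    using le suminf_ennreal2[OF nn sm] by (simp only:)
  then show "(\<Sum>i. cmod (\<mu> (A i)) * n i) \<le> enn2real (variation borel \<mu> UNIV) * c"
    using c0 by (subst (asm) ennreal_le_iff) auto
qed

context fock_like
begin

text \<open>
  The product of the series for \<open>evaluation w\<close> and for \<open>normalized_kernel \<alpha> w\<close> writes the rank-one operator
  at \<open>w\<close> as a double series over \<open>(m, m')\<close> whose terms depend on \<open>w\<close> through the two labels alone. A natural
  number \<open>i\<close> encodes \<open>((m, m'), (j, j'))\<close>, and \<open>A i\<close> is the set of those \<open>w\<close> with labels \<open>j\<close>, \<open>j'\<close> at stages
  \<open>m\<close>, \<open>m'\<close>. Thus the integrand is a series of indicator functions with constant
  rank-one coefficients, and integration replaces the indicator of \<open>A i\<close> by \<open>\<mu> (A i)\<close>.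
\<close>

lemma toeplitz_series:
  assumes cm: "complex_measure borel \<mu>" and fin: "variation borel \<mu> UNIV < \<infinity>"
    and q: "1 \<le> q" and \<epsilon>: "0 < \<epsilon>"
  obtains x' y
  where "\<And>j. x' j \<in> dual X" and "\<And>j. y j \<in> fock_set \<alpha> q"
    and "summable (\<lambda>j. dual_norm X (x' j) * fock_norm \<alpha> q (y j))"
    and "(\<Sum>j. dual_norm X (x' j) * fock_norm \<alpha> q (y j)) \<le> \<alpha> / pi * (enn2real (variation borel \<mu> UNIV) * (1 + \<epsilon>)\<^sup>2)"
    and "\<And>f z. f \<in> carr X \<Longrightarrow> (\<lambda>j. x' j f * y j z) sums toeplitz \<alpha> \<mu> f z"
proof -
  define b where "b m = (if m = 0 then 1 else \<epsilon> * (1/2) ^ m)" for m :: nat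
  have b: "b sums (1 + \<epsilon>)" unfolding b_def[abs_def] by (rule sums_geometric_budget)
  show thesis
  proof (rule evaluation_series[OF \<epsilon>, folded b_def], rule normalized_kernel_series[OF alpha q \<epsilon>, folded b_def])
    fix l l' :: "nat \<Rightarrow> complex \<Rightarrow> nat" and g g'
    assume l[measurable]: "\<And>m. l m \<in> borel \<rightarrow>\<^sub>M count_space UNIV" and gd: "\<And>m j. g m j \<in> dual X"
      and gb: "\<And>m w. dual_norm X (g m (l m w)) \<le> b m"
      and gs: "\<And>f w. f \<in> carr X \<Longrightarrow> (\<lambda>m. g m (l m w) f) sums evaluation w f"
      and l'[measurable]: "\<And>m. l' m \<in> borel \<rightarrow>\<^sub>M count_space UNIV" and gd': "\<And>m j. g' m j \<in> fock_set \<alpha> q"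
      and gb': "\<And>m w. fock_norm \<alpha> q (g' m (l' m w)) \<le> b m"
      and gs': "\<And>z w. (\<lambda>m. g' m (l' m w) z) sums normalized_kernel \<alpha> w z"
    have dn: "0 \<le> dual_norm X (g m j)" for m j by (rule dual_norm_nonneg[OF gd])
    have fn: "0 \<le> fock_norm \<alpha> q (g' m j)" for m j
      using fock_le_fock_norm[OF alpha q gd'] by (simp add: fock_le_def)
    define p1 where "p1 i = prod_decode (fst (prod_decode i))" for i
    define p2 where "p2 i = prod_decode (snd (prod_decode i))" for i
    define A where "A i = {w. l (fst (p1 i)) w = fst (p2 i) \<and> l' (snd (p1 i)) w = snd (p2 i)}" for i
    define x' where "x' i = g (fst (p1 i)) (fst (p2 i))" for i
    define k where "k i = g' (snd (p1 i)) (snd (p2 i))" for i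
    define n where "n i = dual_norm X (x' i) * fock_norm \<alpha> q (k i)" for i
    have n0: "0 \<le> n i" for i using dn fn by (simp add: n_def x'_def k_def)
    have A: "A i \<in> sets borel" for i
    proof -
      have "{w \<in> space borel. l (fst (p1 i)) w = fst (p2 i) \<and> l' (snd (p1 i)) w = snd (p2 i)} \<in> sets borel"
        by measurable
      then show ?thesis by (simp add: A_def)
    qed
    define e where "e w p = prod_encode (prod_encode p, prod_encode (l (fst p) w, l' (snd p) w))" for w p
    have e1: "p1 (e w p) = p" "p2 (e w p) = (l (fst p) w, l' (snd p) w)" for w p
      by (simp_all add: p1_def p2_def e_def)
    have inj: "inj (e w)" for w by (rule injI) (metis e1(1))
    have on: "w \<in> A (e w p)" for w p by (simp add: A_def e1)
    have off: "i \<in> range (e w)" if "w \<in> A i" for w i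
    proof -
      have "p2 i = (l (fst (p1 i)) w, l' (snd (p1 i)) w)"
        using that by (simp add: A_def)
      then have "e w (p1 i) = prod_encode (prod_encode (p1 i), prod_encode (p2 i))" by (simp only: e_def)
      then have "e w (p1 i) = i" by (simp add: p1_def p2_def)
      then show ?thesis by (metis rangeI)
    qed
    have xe: "x' (e w p) = g (fst p) (l (fst p) w)" "k (e w p) = g' (snd p) (l' (snd p) w)" for w p
      by (simp_all add: x'_def k_def e1)
    \<comment> \<open>At a fixed point the active indices are enumerated by \<open>e w\<close>, so the norms add up to a product of two budgets.\<close>
    have budget: "(\<Sum>i<N. indicator (A i) w * n i) \<le> (1 + \<epsilon>)\<^sup>2" for N w
    proof -
      have s: "summable (\<lambda>m. dual_norm X (g m (l m w)))" "(\<Sum>m. dual_norm X (g m (l m w))) \<le> 1 + \<epsilon>"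
      proof -
        show s: "summable (\<lambda>m. dual_norm X (g m (l m w)))"
          by (rule summable_comparison_test'[OF sums_summable[OF b]]) (simp add: dn gb)
        show "(\<Sum>m. dual_norm X (g m (l m w))) \<le> 1 + \<epsilon>"
          using suminf_le[OF gb s sums_summable[OF b]] sums_unique[OF b] by simp
      qed
      have s': "summable (\<lambda>m. fock_norm \<alpha> q (g' m (l' m w)))" "(\<Sum>m. fock_norm \<alpha> q (g' m (l' m w))) \<le> 1 + \<epsilon>"
      proof -
        show s: "summable (\<lambda>m. fock_norm \<alpha> q (g' m (l' m w)))"
          by (rule summable_comparison_test'[OF sums_summable[OF b]]) (simp add: fn gb')
        show "(\<Sum>m. fock_norm \<alpha> q (g' m (l' m w))) \<le> 1 + \<epsilon>"
          using suminf_le[OF gb' s sums_summable[OF b]] sums_unique[OF b] by simp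
      qed
      let ?s = "(\<Sum>m. dual_norm X (g m (l m w))) * (\<Sum>m. fock_norm \<alpha> q (g' m (l' m w)))"
      have "((\<lambda>p. n (e w p)) has_sum ?s) UNIV"
        using has_sum_mult[OF _ summable_sums[OF s(1)] _ summable_sums[OF s'(1)]] s(1) s'(1) dn fn
        by (simp add: n_def xe)
      then have "((\<lambda>i. indicator (A i) w * n i) has_sum ?s) UNIV"
        by (subst has_sum_indicator_reindex[where e="e w" and w=w and A=A, OF inj on off])
      then have sums: "(\<lambda>i. indicator (A i) w * n i) sums ?s" by (rule has_sum_imp_sums)
      have "(\<Sum>i<N. indicator (A i) w * n i) \<le> ?s"
        unfolding sums_unique[OF sums] using sums_summable[OF sums] n0 by (intro sum_le_suminf) auto
      also have "?s \<le> (1 + \<epsilon>) * (1 + \<epsilon>)"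
        using s s' \<epsilon> by (intro mult_mono suminf_nonneg fn) auto
      finally show ?thesis by (simp add: power2_eq_square)
    qed
    have expansion: "(\<lambda>i. indicator (A i) w * (x' i f * k i z)) sums (evaluation w f * normalized_kernel \<alpha> w z)"
      if f: "f \<in> carr X" for w f z
    proof -
      define E where "E = exp (\<alpha> / 2 * (cmod z)\<^sup>2)"
      have E: "0 \<le> E" by (simp add: E_def)
      have s: "summable (\<lambda>m. cmod (g m (l m w) f))"
      proof (rule summable_comparison_test'[OF summable_mult2[OF sums_summable[OF b], of "nrm X f"]])
        show "norm (cmod (g m (l m w) f)) \<le> b m * nrm X f" for m
          using order_trans[OF dual_norm_bound[OF gd f] mult_right_mono[OF gb nrm_nonneg[OF f]]] by simp
      qed
      have s': "summable (\<lambda>m. cmod (g' m (l' m w) z))"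
      proof (rule summable_comparison_test'[OF summable_mult2[OF sums_summable[OF b], of E]])
        show "norm (cmod (g' m (l' m w) z)) \<le> b m * E" for m
          using order_trans[OF norm_le_fock_norm[OF alpha q gd', of m "l' m w" z] mult_right_mono[OF gb']]
          by (simp add: E_def)
      qed
      have "((\<lambda>p. x' (e w p) f * k (e w p) z) has_sum (evaluation w f * normalized_kernel \<alpha> w z)) UNIV"
        using has_sum_mult[OF s gs[OF f] s' gs'] by (simp add: xe)
      then have "((\<lambda>i. indicator (A i) w * (x' i f * k i z)) has_sum (evaluation w f * normalized_kernel \<alpha> w z)) UNIV"
        by (subst has_sum_indicator_reindex[where e="e w" and w=w and A=A, OF inj on off])
      then show ?thesis by (rule has_sum_imp_sums)
    qed
    have bound: "(\<Sum>i<N. indicator (A i) w * cmod (x' i f * k i z)) \<le> (1 + \<epsilon>)\<^sup>2 * (nrm X f * exp (\<alpha> / 2 * (cmod z)\<^sup>2))"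
      if f: "f \<in> carr X" for N w f z
    proof -
      define E where "E = exp (\<alpha> / 2 * (cmod z)\<^sup>2)"
      have "cmod (x' i f * k i z) \<le> n i * (nrm X f * E)" for i
      proof -
        have "cmod (x' i f * k i z) \<le> (dual_norm X (x' i) * nrm X f) * (fock_norm \<alpha> q (k i) * E)"
          unfolding norm_mult E_def
          by (intro mult_mono dual_norm_bound norm_le_fock_norm alpha q f mult_nonneg_nonneg nrm_nonneg)
             (auto simp: x'_def k_def gd gd' dn fn)
        then show ?thesis by (simp add: n_def mult_ac)
      qed
      then have "(\<Sum>i<N. indicator (A i) w * cmod (x' i f * k i z)) \<le> (\<Sum>i<N. (indicator (A i) w * n i) * (nrm X f * E))"
        unfolding mult.assoc by (intro sum_mono mult_left_mono) auto
      also have "\<dots> = (\<Sum>i<N. indicator (A i) w * n i) * (nrm X f * E)"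
        by (rule sum_distrib_right[symmetric])
      also have "\<dots> \<le> (1 + \<epsilon>)\<^sup>2 * (nrm X f * E)"
        using nrm_nonneg[OF f] by (intro mult_right_mono budget) (simp add: E_def)
      finally show ?thesis by (simp add: E_def)
    qed
    define y where "y i = fscale (of_real (\<alpha> / pi) * \<mu> (A i)) (k i)" for i
    have kmem: "k i \<in> fock_set \<alpha> q" for i by (simp add: k_def gd')
    have yn: "dual_norm X (x' i) * fock_norm \<alpha> q (y i) = \<alpha> / pi * (cmod (\<mu> (A i)) * n i)" for i
      using alpha unfolding y_def fock_norm_fscale[OF alpha q kmem] norm_mult norm_of_real n_def by simp
    note tot = summable_sum_le_of_var_measure[OF cm fin A n0 _ budget]
    have e0: "0 \<le> (1 + \<epsilon>)\<^sup>2" by simp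
    show thesis
    proof (rule that[of x' y])
      show "x' j \<in> dual X" for j by (simp add: x'_def gd)
      show "y j \<in> fock_set \<alpha> q" for j unfolding y_def by (intro fock_set_fscale alpha q kmem)
      show "summable (\<lambda>j. dual_norm X (x' j) * fock_norm \<alpha> q (y j))"
        unfolding yn by (intro summable_mult tot(1)[OF e0])
      show "(\<Sum>j. dual_norm X (x' j) * fock_norm \<alpha> q (y j)) \<le> \<alpha> / pi * (enn2real (variation borel \<mu> UNIV) * (1 + \<epsilon>)\<^sup>2)"
        unfolding yn suminf_mult[OF tot(1)[OF e0]] using alpha by (intro mult_left_mono tot(2)[OF e0]) simp
      fix f z assume f: "f \<in> carr X"
      have "(\<lambda>i. \<mu> (A i) * (x' i f * k i z)) sums cm_integral borel \<mu> (\<lambda>w. evaluation w f * normalized_kernel \<alpha> w z)"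
        by (rule cm_integral_series[OF cm _ A expansion[OF f] bound[OF f]]) (use fin in simp)
      then have "(\<lambda>i. of_real (\<alpha> / pi) * (\<mu> (A i) * (x' i f * k i z))) sums toeplitz \<alpha> \<mu> f z"
        unfolding toeplitz_def toeplitz_integrand by (rule sums_mult)
      then show "(\<lambda>j. x' j f * y j z) sums toeplitz \<alpha> \<mu> f z"
        by (simp add: y_def fscale_def mult_ac)
    qed
  qed
qed

text \<open>
  Weighted functions in the domain are bounded, so the defining integral converges on the whole domain and
  already is the extension from the span of the kernels. The representation varies with \<open>\<epsilon>\<close> while the
  operator does not, hence the infimum over representations obeys the limiting bound.
\<close>

theorem toeplitz_nuclear:
  assumes cm: "complex_measure borel \<mu>" and fin: "variation borel \<mu> UNIV < \<infinity>" and q: "1 \<le> q"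
  shows "toeplitz \<alpha> \<mu> \<in> nuclear_ops X (fock \<alpha> q)"
    and "nuclear_norm X (fock \<alpha> q) (toeplitz \<alpha> \<mu>) \<le> \<alpha> / pi * enn2real (variation borel \<mu> UNIV)"
    and "extends_toeplitz \<alpha> \<mu> X (toeplitz \<alpha> \<mu>)"
proof -
  let ?V = "enn2real (variation borel \<mu> UNIV)"
  have main: "toeplitz \<alpha> \<mu> \<in> nuclear_ops X (fock \<alpha> q) \<and>
     nuclear_norm X (fock \<alpha> q) (toeplitz \<alpha> \<mu>) \<le> \<alpha> / pi * (?V * (1 + \<epsilon>)\<^sup>2)" if "0 < \<epsilon>" for \<epsilon>
  proof (rule toeplitz_series[OF cm fin q that])
    fix x' y
    assume *: "\<And>j. x' j \<in> dual X" "\<And>j. y j \<in> fock_set \<alpha> q"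
      "summable (\<lambda>j. dual_norm X (x' j) * fock_norm \<alpha> q (y j))"
      "(\<Sum>j. dual_norm X (x' j) * fock_norm \<alpha> q (y j)) \<le> \<alpha> / pi * (?V * (1 + \<epsilon>)\<^sup>2)"
      "\<And>f z. f \<in> carr X \<Longrightarrow> (\<lambda>j. x' j f * y j z) sums toeplitz \<alpha> \<mu> f z"
    show ?thesis
      using nuclear_of_series[OF q *(1,2,3,5)] *(4) by (meson order_trans)
  qed
  show "toeplitz \<alpha> \<mu> \<in> nuclear_ops X (fock \<alpha> q)" using main[of 1] by simp
  have "((\<lambda>\<epsilon>. \<alpha> / pi * (?V * (1 + \<epsilon>)\<^sup>2)) \<longlongrightarrow> \<alpha> / pi * (?V * (1 + 0)\<^sup>2)) (at_right 0)"
    by (intro tendsto_intros)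
  moreover have "\<forall>\<^sub>F \<epsilon> in at_right 0. nuclear_norm X (fock \<alpha> q) (toeplitz \<alpha> \<mu>) \<le> \<alpha> / pi * (?V * (1 + \<epsilon>)\<^sup>2)"
    using main eventually_at_right_less[of "0::real"] by (auto elim: eventually_mono)
  ultimately have "nuclear_norm X (fock \<alpha> q) (toeplitz \<alpha> \<mu>) \<le> \<alpha> / pi * (?V * (1 + 0)\<^sup>2)"
    by (rule tendsto_lowerbound) simp
  then show "nuclear_norm X (fock \<alpha> q) (toeplitz \<alpha> \<mu>) \<le> \<alpha> / pi * ?V" by simp
  show "extends_toeplitz \<alpha> \<mu> X (toeplitz \<alpha> \<mu>)"
    using kernel_span_subset by (simp add: extends_toeplitz_def)
qed

end

theorem theorem3p4:
  fixes \<alpha> :: real and \<mu> :: "complex set \<Rightarrow> complex" and p q s :: ereal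
  assumes "\<alpha> > 0"
    and "complex_measure borel \<mu>"
    and "variation borel \<mu> UNIV < \<infinity>"
    and "1 \<le> p" and "p < \<infinity>" and "1 \<le> q" and "1 \<le> s"
  shows "(\<exists>T \<in> nuclear_ops (little_fock \<alpha>) (fock \<alpha> s).
            extends_toeplitz \<alpha> \<mu> (little_fock \<alpha>) T \<and>
            nuclear_norm (little_fock \<alpha>) (fock \<alpha> s) T
              \<le> \<alpha> / pi * enn2real (variation borel \<mu> UNIV)) \<and>
         (\<exists>T \<in> nuclear_ops (fock \<alpha> p) (fock \<alpha> q).
            extends_toeplitz \<alpha> \<mu> (fock \<alpha> p) T \<and>
            nuclear_norm (fock \<alpha> p) (fock \<alpha> q) T
              \<le> \<alpha> / pi * enn2real (variation borel \<mu> UNIV))"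
  using fock_like.toeplitz_nuclear[OF fock_like_little_fock[OF assms(1)] assms(2,3,7)]
    fock_like.toeplitz_nuclear[OF fock_like_fock[OF assms(1,4)] assms(2,3,6)]
  by blast

end
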